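(* Consider a radial power distribution network with one slack bus (bus $0$) and $n\ge 1$ PQ buses described by the branch flow model, satisfying the assumption that the active and reactive power flows on each line are nonnegative, i.e. $p_{ij}\ge 0$ and $q_{ij}\ge 0$ for all $(i,j)\in E$. Then at every point of the voltage stability region the following inequalities between (well-defined) real numbers hold: $$\mathrm{VSI}\;\le\;\mathrm{AVSI}\;\le\;\mathrm{VSI}-\rho\,\ln(1-\rho),$$ where $\mathrm{VSI}$, $\mathrm{AVSI}$, $\rho$ and the voltage stability region are as defined in the context.
   Context: **Graph.** $G=(N,E)$ is a directed rooted tree with nodes (buses) $N=\{0,1,\dots,n\}$, root $0$ (the substation), and $n$ edges (lines), all directed away from the root: $(i,j)\in E$ means that $i$ is the parent of $j$. For $j\neq 0$, $\pi(j)$ is the unique parent of $j$; $\delta(i)$ is the set of children of $i$. Edges are indexed by their child node: the $j$-th edge is $(\pi(j),j)$, $j=1,\dots,n$. Rows of matrices of height $n+1$ are indexed by nodes $0,1,\dots,n$ in this order. **Matrices.** $\Pi,\Delta\in\{0,1\}^{(n+1)\times n}$: $\Pi$ has entry $1$ in row $j$ and the column of edge $(i,j)$ with $i=\pi(j)$ (row $0$ of $\Pi$ is zero), and $0$ elsewhere; $\Delta$ has entry $1$ in row $i$ and the column of each edge $(i,j)$ with $j\in\delta(i)$, and $0$ elsewhere. $A=\Delta-\Pi$. $\Delta_2$ and $A_2$ are the $n\times n$ matrices obtained by deleting the first row (node $0$) of $\Delta$ and $A$. For a vector $x$, $[x]$ is the diagonal matrix with the entries of $x$ on its diagonal. $\mathbf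 e_1\in\mathbb R^{n+1}$ is the first canonical basis vector. **Variables.** Each line $(i,j)$ has impedance $r_{ij}+\mathbf{j}x_{ij}$ with $r_{ij},x_{ij}\ge 0$, squared current magnitude $\ell_{ij}$ and sending-end active and reactive power flows $p_{ij},q_{ij}$; each bus $i$ has squared voltage magnitude $v_i$ and net active and reactive power demands $p_i,q_i$. Stack these as $r,x,\ell,\overline p,\overline q\in\mathbb R^n$ (indexed by edges) and $v,p,q\in\mathbb R^{n+1}$ (indexed by nodes). **Branch flow model.** With state $u=(\overline p,\overline q,\ell,v_1,\dots,v_n,p_0,q_0)\in\mathbb R^{4n+2}$ and parameters $\xi=(v_0,p_1,\dots,p_n,q_1,\dots,q_n)\in\mathbb R^{2n+1}$, the equation $\varphi(u,\xi)=\mathbf 0$ is the system $$\Pi(\overline p-[r]\ell)-\Delta\overline p-p=0,\qquad \Pi(\overline q-[x]\ell)-\Delta\overline q-q=0,$$ $$\Delta^\top v-\Pi^\top v-2([r]\overline p+[x]\overline q)+([r]^2+[x]^2)\ell=0,\qquad [\overline p]\overline p+[\overline q]\overline q-[\Delta^\top v]\ell=0,$$ with $\varphi$ being the stacked vector of left-hand sides in this order. **Power flow Jacobian.** $\varphi_u=\partial\varphi/\partial u$, i.e. $$\varphi_u=\begin{bmatrix}-A&\mathbf 0&-\Pi[r]&\mathbf 0&-\mathbf e_1&\mathbf 0\\ \mathbf 0&-A&-\Pi[x]&\mathbf 0&\mathbf 0&-\mathbf e_1\\ -2[r]&-2[x]&[r]^2+[x]^2&A_2^\top&\mathbf 0&\mathbf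 0\\ 2[\overline p]&2[\overline q]&-[\Delta^\top v]&-[\ell]\Delta_2^\top&\mathbf 0&\mathbf 0\end{bmatrix}.$$ **Reduced power flow Jacobian** ($n\times n$). $$\varphi_u'=[\Delta^\top v]+2[\overline p]A_2^{-1}[r]+2[\overline q]A_2^{-1}[x]-[\ell]\Delta_2^\top(A_2^\top)^{-1}\big([r]^2+2[r]A_2^{-1}[r]+[x]^2+2[x]A_2^{-1}[x]\big).$$ Its diagonal entries are, with $i=\pi(j)$, $$\varphi'_{u,jj}=v_i-2p_{ij}r_{ij}-2q_{ij}x_{ij}-2\ell_{ij}\big(r_{ij}\overline{r_{0i}}+x_{ij}\overline{x_{0i}}\big),$$ where $\overline{r_{0i}}$ and $\overline{x_{0i}}$ are the sums of the $r$'s, respectively the $x$'s, of the lines on the path from node $0$ to node $i$. **Indices.** $\varphi'_{u,\mathrm{diag}}$ and $\varphi'_{u,\mathrm{off}}$ are the matrices containing only the diagonal, respectively only the off-diagonal, elements of $\varphi_u'$ (so $\varphi_u'=\varphi'_{u,\mathrm{diag}}+\varphi'_{u,\mathrm{off}}$). Define $$\mathrm{VSI}=\frac{\ln(\det(\varphi_u'))}{n},\qquad \mathrm{AVSI}=\frac1n\ln\Big(\prod_{j=1}^n\varphi'_{u,jj}\Big)=\frac1n\sum_{j=1}^n\ln(\varphi'_{u,jj}),$$ and let $\rho$ be the spectral radius of $(\varphi'_{u,\mathrm{diag}})^{-1}\varphi'_{u,\mathrm{off}}$, i.e. the maximum modulus of its eigenvalues. **Voltage stability region.** A power flow solution is a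 pair $(u,\xi)$ with $\varphi(u,\xi)=\mathbf 0$, $v_0=1$, and $v,\ell$ entrywise nonnegative (being squared magnitudes). The operating points of a network satisfying the assumption of the claim are the power flow solutions with $p_{ij},q_{ij}\ge 0$ for all $(i,j)\in E$. The flat voltage solution is the one with $v_i=1$ for all $i$, $p=q=0$, $\overline p=\overline q=\ell=0$. The voltage stability region is the (relatively open) connected set of operating points that contains the flat voltage solution and on which $\det(\varphi_u)\neq0$, i.e. the connected component containing the flat voltage solution of the set of operating points with $\det(\varphi_u)\ne 0$. *)

theory Defs
  imports "HOL-Analysis.Function_Topology" "Jordan_Normal_Form.Spectral_Radius"
begin

section \<open>The network\<close>

text \<open>
  Nodes are \<open>0, \<dots>, n\<close> with root \<open>0\<close>; a pair \<open>(i, j)\<close> is the edge from the parent \<open>i\<close> to its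
  child \<open>j\<close>.  Edges are indexed by their child \<open>j = 1, \<dots>, n\<close>, so \<open>r j\<close>, \<open>P j\<close>, \<dots> belong to
  the edge entering \<open>j\<close>.  Vectors and matrices count from 0: edge \<open>j\<close> occupies position \<open>j - 1\<close>,
  node \<open>i\<close> occupies position \<open>i\<close>.
\<close>

definition rooted_tree :: "nat \<Rightarrow> (nat \<times> nat) set \<Rightarrow> bool" where
  "rooted_tree n E \<longleftrightarrow>
     E \<subseteq> {0..n} \<times> {1..n} \<and>
     (\<forall>j\<in>{1..n}. \<exists>!i. (i, j) \<in> E) \<and>
     (\<forall>j\<in>{0..n}. (0, j) \<in> E\<^sup>*)"

definition edge_vec :: "nat \<Rightarrow> (nat \<Rightarrow> real) \<Rightarrow> real vec" where
  "edge_vec n f = vec n (\<lambda>k. f (Suc k))"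

definition node_vec :: "nat \<Rightarrow> (nat \<Rightarrow> real) \<Rightarrow> real vec" where
  "node_vec n f = vec (Suc n) f"

definition diag_of_vec :: "real vec \<Rightarrow> real mat" where
  "diag_of_vec w = mat_diag (dim_vec w) (\<lambda>k. w $ k)"

definition Pi_mat :: "nat \<Rightarrow> real mat" where
  "Pi_mat n = mat (Suc n) n (\<lambda>(i, k). if i = Suc k then 1 else 0)"

definition Delta_mat :: "nat \<Rightarrow> (nat \<times> nat) set \<Rightarrow> real mat" where
  "Delta_mat n E = mat (Suc n) n (\<lambda>(i, k). if (i, Suc k) \<in> E then 1 else 0)"

definition A_mat :: "nat \<Rightarrow> (nat \<times> nat) set \<Rightarrow> real mat" where
  "A_mat n E = Delta_mat n E - Pi_mat n"

definition delete_first_row :: "'a mat \<Rightarrow> 'a mat" where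
  "delete_first_row M = mat (dim_row M - 1) (dim_col M) (\<lambda>(i, k). M $$ (Suc i, k))"

definition Delta2_mat :: "nat \<Rightarrow> (nat \<times> nat) set \<Rightarrow> real mat" where
  "Delta2_mat n E = delete_first_row (Delta_mat n E)"

definition A2_mat :: "nat \<Rightarrow> (nat \<times> nat) set \<Rightarrow> real mat" where
  "A2_mat n E = delete_first_row (A_mat n E)"

text \<open>Unspecified unless \<open>M\<close> is invertible.\<close>

definition mat_inv :: "real mat \<Rightarrow> real mat" where
  "mat_inv M = the (mat_inverse M)"

definition append_cols :: "'a :: zero mat \<Rightarrow> 'a mat \<Rightarrow> 'a mat" (infixr \<open>@\<^sub>c\<close> 66) where
  "M @\<^sub>c M' = four_block_mat M M' (0\<^sub>m 0 (dim_col M)) (0\<^sub>m 0 (dim_col M'))"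


section \<open>The branch flow model\<close>

text \<open>
  A point \<open>(P, Q, L, v, p, q)\<close> carries the line flows \<open>P\<close>, \<open>Q\<close>, the squared currents \<open>L\<close>, and at
  the nodes the squared voltages \<open>v\<close> and the demands \<open>p\<close>, \<open>q\<close>.  It is the pair of the state
  \<open>u = (P, Q, L, v\<^sub>1, \<dots>, v\<^sub>n, p\<^sub>0, q\<^sub>0)\<close> and the parameter \<open>\<xi> = (v\<^sub>0, p\<^sub>1, \<dots>, p\<^sub>n, q\<^sub>1, \<dots>, q\<^sub>n)\<close>, with
  the coordinates regrouped.
\<close>

type_synonym point =
  "(nat \<Rightarrow> real) \<times> (nat \<Rightarrow> real) \<times> (nat \<Rightarrow> real) \<times> (nat \<Rightarrow> real) \<times> (nat \<Rightarrow> real) \<times> (nat \<Rightarrow> real)"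

text \<open>
  Points are zero outside the index ranges.  With the product topology on functions this makes
  \<open>point_space n\<close> a copy of the Euclidean space of dimension \<open>(4 n + 2) + (2 n + 1)\<close>.
\<close>

definition point_space :: "nat \<Rightarrow> point set" where
  "point_space n = {(P, Q, L, v, p, q).
     (\<forall>j. j \<notin> {1..n} \<longrightarrow> P j = 0 \<and> Q j = 0 \<and> L j = 0) \<and>
     (\<forall>i. i \<notin> {0..n} \<longrightarrow> v i = 0 \<and> p i = 0 \<and> q i = 0)}"

definition phi ::
  "nat \<Rightarrow> (nat \<times> nat) set \<Rightarrow> (nat \<Rightarrow> real) \<Rightarrow> (nat \<Rightarrow> real) \<Rightarrow> point \<Rightarrow> real vec" where
  "phi n E r x = (\<lambda>(P, Q, L, v, p, q).
     let PM = Pi_mat n; DM = Delta_mat n E;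
         R = diag_of_vec (edge_vec n r); X = diag_of_vec (edge_vec n x);
         P' = edge_vec n P; Q' = edge_vec n Q; L' = edge_vec n L;
         v' = node_vec n v; p' = node_vec n p; q' = node_vec n q
     in (PM *\<^sub>v (P' - R *\<^sub>v L') - DM *\<^sub>v P' - p')
        @\<^sub>v (PM *\<^sub>v (Q' - X *\<^sub>v L') - DM *\<^sub>v Q' - q')
        @\<^sub>v (DM\<^sup>T *\<^sub>v v' - PM\<^sup>T *\<^sub>v v' - 2 \<cdot>\<^sub>v (R *\<^sub>v P' + X *\<^sub>v Q') + (R * R + X * X) *\<^sub>v L')
        @\<^sub>v (diag_of_vec P' *\<^sub>v P' + diag_of_vec Q' *\<^sub>v Q' - diag_of_vec (DM\<^sup>T *\<^sub>v v') *\<^sub>v L'))"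

text \<open>The Jacobian matrix of \<open>phi\<close> with respect to \<open>u = (P, Q, L, v\<^sub>1, \<dots>, v\<^sub>n, p\<^sub>0, q\<^sub>0)\<close>.\<close>

definition jacobian ::
  "nat \<Rightarrow> (nat \<times> nat) set \<Rightarrow> (nat \<Rightarrow> real) \<Rightarrow> (nat \<Rightarrow> real) \<Rightarrow> point \<Rightarrow> real mat" where
  "jacobian n E r x = (\<lambda>(P, Q, L, v, p, q).
     let PM = Pi_mat n; DM = Delta_mat n E; A = A_mat n E;
         D2 = Delta2_mat n E; A2 = A2_mat n E;
         R = diag_of_vec (edge_vec n r); X = diag_of_vec (edge_vec n x);
         dP = diag_of_vec (edge_vec n P); dQ = diag_of_vec (edge_vec n Q);
         dL = diag_of_vec (edge_vec n L); dV = diag_of_vec (DM\<^sup>T *\<^sub>v node_vec n v);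
         Z = 0\<^sub>m (Suc n) n; z1 = 0\<^sub>m (Suc n) 1; z2 = 0\<^sub>m n 1;
         e1 = mat_of_cols (Suc n) [unit_vec (Suc n) 0]
     in (- A @\<^sub>c Z @\<^sub>c - (PM * R) @\<^sub>c Z @\<^sub>c - e1 @\<^sub>c z1)
        @\<^sub>r (Z @\<^sub>c - A @\<^sub>c - (PM * X) @\<^sub>c Z @\<^sub>c z1 @\<^sub>c - e1)
        @\<^sub>r ((- 2) \<cdot>\<^sub>m R @\<^sub>c (- 2) \<cdot>\<^sub>m X @\<^sub>c (R * R + X * X) @\<^sub>c A2\<^sup>T @\<^sub>c z2 @\<^sub>c z2)
        @\<^sub>r (2 \<cdot>\<^sub>m dP @\<^sub>c 2 \<cdot>\<^sub>m dQ @\<^sub>c - dV @\<^sub>c - (dL * D2\<^sup>T) @\<^sub>c z2 @\<^sub>c z2))"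

definition reduced_jacobian ::
  "nat \<Rightarrow> (nat \<times> nat) set \<Rightarrow> (nat \<Rightarrow> real) \<Rightarrow> (nat \<Rightarrow> real) \<Rightarrow> point \<Rightarrow> real mat" where
  "reduced_jacobian n E r x = (\<lambda>(P, Q, L, v, p, q).
     let DM = Delta_mat n E; D2 = Delta2_mat n E; A2 = A2_mat n E;
         R = diag_of_vec (edge_vec n r); X = diag_of_vec (edge_vec n x);
         dP = diag_of_vec (edge_vec n P); dQ = diag_of_vec (edge_vec n Q);
         dL = diag_of_vec (edge_vec n L); dV = diag_of_vec (DM\<^sup>T *\<^sub>v node_vec n v)
     in dV + 2 \<cdot>\<^sub>m (dP * mat_inv A2 * R) + 2 \<cdot>\<^sub>m (dQ * mat_inv A2 * X)
        - dL * D2\<^sup>T * mat_inv (A2\<^sup>T)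
          * (R * R + 2 \<cdot>\<^sub>m (R * mat_inv A2 * R) + X * X + 2 \<cdot>\<^sub>m (X * mat_inv A2 * X)))"

definition power_flow_solutions ::
  "nat \<Rightarrow> (nat \<times> nat) set \<Rightarrow> (nat \<Rightarrow> real) \<Rightarrow> (nat \<Rightarrow> real) \<Rightarrow> point set" where
  "power_flow_solutions n E r x = {(P, Q, L, v, p, q).
     (P, Q, L, v, p, q) \<in> point_space n \<and>
     phi n E r x (P, Q, L, v, p, q) = 0\<^sub>v (4 * n + 2) \<and>
     v 0 = 1 \<and> (\<forall>i\<in>{0..n}. v i \<ge> 0) \<and> (\<forall>j\<in>{1..n}. L j \<ge> 0)}"

definition operating_points ::
  "nat \<Rightarrow> (nat \<times> nat) set \<Rightarrow> (nat \<Rightarrow> real) \<Rightarrow> (nat \<Rightarrow> real) \<Rightarrow> point set" where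
  "operating_points n E r x = {(P, Q, L, v, p, q).
     (P, Q, L, v, p, q) \<in> power_flow_solutions n E r x \<and>
     (\<forall>j\<in>{1..n}. P j \<ge> 0 \<and> Q j \<ge> 0)}"

definition flat_voltage_solution :: "nat \<Rightarrow> point" where
  "flat_voltage_solution n =
     (\<lambda>_. 0, \<lambda>_. 0, \<lambda>_. 0, \<lambda>i. if i \<le> n then 1 else 0, \<lambda>_. 0, \<lambda>_. 0)"

definition voltage_stability_region ::
  "nat \<Rightarrow> (nat \<times> nat) set \<Rightarrow> (nat \<Rightarrow> real) \<Rightarrow> (nat \<Rightarrow> real) \<Rightarrow> point set" where
  "voltage_stability_region n E r x =
     connected_component_set
       {z \<in> operating_points n E r x. det (jacobian n E r x z) \<noteq> 0}
       (flat_voltage_solution n)"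


section \<open>The indices, as functions of the reduced Jacobian\<close>

definition diag_part :: "real mat \<Rightarrow> real mat" where
  "diag_part J = mat_diag (dim_row J) (\<lambda>j. J $$ (j, j))"

definition off_part :: "real mat \<Rightarrow> real mat" where
  "off_part J = J - diag_part J"

definition VSI :: "real mat \<Rightarrow> real" where
  "VSI J = ln (det J) / real (dim_row J)"

definition AVSI :: "real mat \<Rightarrow> real" where
  "AVSI J = ln (\<Prod>j<dim_row J. J $$ (j, j)) / real (dim_row J)"

definition rho :: "real mat \<Rightarrow> real" where
  "rho J = spectral_radius (map_mat complex_of_real (mat_inv (diag_part J) * off_part J))"

end

theory Submission
  imports "HOL-Analysis.Complex_Transcendental" Defs
begin

text \<open>
  With \<open>T\<close> the ancestor matrix of the tree, \<open>A\<^sub>2\<inverse> = - T\<close>. Nonnegative flows therefore make all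
  off-diagonal entries of the reduced Jacobian \<open>J\<close> nonpositive. A matrix of this sign pattern is a
  nonsingular M-matrix iff \<open>J w > 0\<close> for some \<open>w > 0\<close>, which is an open condition, and for
  \<open>det J \<noteq> 0\<close> also iff the solution of \<open>J y = (1, \<dots>, 1)\<close> is nonnegative, which is a closed one.
  Since \<open>det J\<close> cannot vanish where the full Jacobian is nonsingular, and \<open>J\<close> is the identity at the
  flat solution, connectedness makes \<open>J\<close> an M-matrix on the whole stability region.

  Then \<open>J = D (1 - B)\<close> with \<open>D\<close> the diagonal part, \<open>B \<ge> 0\<close> of zero trace and spectral radius
  \<open>\<rho> < 1\<close>, and \<open>- ln (det (1 - B))\<close> is the sum of \<open>tr (B\<^sup>k) / k\<close> over \<open>k \<ge> 2\<close>. Its terms lie between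
  \<open>0\<close> and \<open>n \<rho>\<^sup>k / k\<close>, so the sum is at most
  \<open>n (- ln (1 - \<rho>) - \<rho>) \<le> - n \<rho> ln (1 - \<rho>)\<close>.
\<close>

unbundle no vec_syntax

section \<open>Determinants and traces of powers\<close>

lemma trace_mult_commute:
  fixes A B :: "'a :: comm_semiring_0 mat"
  assumes "A \<in> carrier_mat n m" "B \<in> carrier_mat m n"
  shows "(\<Sum>i<n. (A * B) $$ (i, i)) = (\<Sum>i<m. (B * A) $$ (i, i))"
proof -
  have "(\<Sum>i<n. (A * B) $$ (i, i)) = (\<Sum>i<n. \<Sum>k<m. A $$ (i, k) * B $$ (k, i))"
    using assms by (intro sum.cong) (auto simp: scalar_prod_def atLeast0LessThan)
  also have "\<dots> = (\<Sum>k<m. \<Sum>i<n. B $$ (k, i) * A $$ (i, k))"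
    by (subst sum.swap) (simp add: mult.commute)
  also have "\<dots> = (\<Sum>k<m. (B * A) $$ (k, k))"
    using assms by (intro sum.cong) (auto simp: scalar_prod_def atLeast0LessThan)
  finally show ?thesis .
qed

lemma upper_triangular_mult:
  fixes A B :: "'a :: semiring_0 mat"
  assumes A: "A \<in> carrier_mat n n" "upper_triangular A"
    and B: "B \<in> carrier_mat n n" "upper_triangular B"
  shows "upper_triangular (A * B)"
    and "i < n \<Longrightarrow> (A * B) $$ (i, i) = A $$ (i, i) * B $$ (i, i)"
proof -
  have entry: "(A * B) $$ (i, j) = (\<Sum>k\<in>{0..<n}. A $$ (i, k) * B $$ (k, j))"
    if "i < n" "j < n" for i j
    using that A B by (auto simp: scalar_prod_def)
  have zero: "A $$ (i, k) * B $$ (k, j) = 0" if "i < n" "k < n" "k < i \<or> j < k" for i j k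
    using that upper_triangularD[OF A(2)] upper_triangularD[OF B(2)] A(1) B(1) by auto
  show "upper_triangular (A * B)"
  proof (rule upper_triangularI)
    fix i j assume "j < i" "i < dim_row (A * B)"
    then have "i < n" "j < n" "j < i" using A by auto
    then show "(A * B) $$ (i, j) = 0"
      by (subst entry) (auto intro!: sum.neutral zero)
  qed
  assume i: "i < n"
  have "(\<Sum>k\<in>{0..<n}. A $$ (i, k) * B $$ (k, i)) = (\<Sum>k\<in>{i}. A $$ (i, k) * B $$ (k, i))"
    using i by (intro sum.mono_neutral_right) (auto intro!: zero)
  then show "(A * B) $$ (i, i) = A $$ (i, i) * B $$ (i, i)" using entry[OF i i] by simp
qed

lemma upper_triangular_pow:
  fixes A :: "'a :: comm_semiring_1 mat"
  assumes A: "A \<in> carrier_mat n n" "upper_triangular A"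
  shows "upper_triangular (A ^\<^sub>m k) \<and> (\<forall>i<n. (A ^\<^sub>m k) $$ (i, i) = (A $$ (i, i)) ^ k)"
proof (induction k)
  case 0
  then show ?case using A by auto
next
  case (Suc k)
  then show ?case
    using upper_triangular_mult[OF pow_carrier_mat[OF A(1)] _ A] by (auto simp: mult.commute)
qed

text \<open>Schur triangularisation makes each power similar to a triangular matrix whose diagonal
  carries the powers of the eigenvalues; the cyclic property \<open>trace_mult_commute\<close>
  removes the change of basis.\<close>

lemma trace_pow_eq_sum_eigenvalues:
  fixes A :: "'a :: conjugatable_ordered_field mat"
  assumes A: "A \<in> carrier_mat n n" and cp: "char_poly A = (\<Prod>a\<leftarrow>es. [:- a, 1:])"
  shows "(\<Sum>i<n. (A ^\<^sub>m k) $$ (i, i)) = (\<Sum>a\<leftarrow>es. a ^ k)"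
proof -
  obtain C P Q where C: "similar_mat_wit A C P Q" "upper_triangular C" "diag_mat C = es"
    using schur_decomposition[OF A cp] by (metis prod_cases3)
  note w = similar_mat_witD2[OF A C(1)]
  note wk = similar_mat_witD2[OF pow_carrier_mat[OF A] similar_mat_wit_pow[OF C(1), of k]]
  have "(\<Sum>i<n. (A ^\<^sub>m k) $$ (i, i)) = (\<Sum>i<n. (P * (C ^\<^sub>m k * Q)) $$ (i, i))"
    using wk assoc_mult_mat[OF wk(6,5,7)] by simp
  also have "\<dots> = (\<Sum>i<n. ((C ^\<^sub>m k * Q) * P) $$ (i, i))"
    using wk by (intro trace_mult_commute) auto
  also have "(C ^\<^sub>m k * Q) * P = C ^\<^sub>m k"
    using wk assoc_mult_mat[OF wk(5,7,6)] right_mult_one_mat[OF wk(5)] by simp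
  also have "(\<Sum>i<n. (C ^\<^sub>m k) $$ (i, i)) = (\<Sum>i<n. (C $$ (i, i)) ^ k)"
    using upper_triangular_pow[OF w(5) C(2)] by simp
  also have "\<dots> = (\<Sum>a\<leftarrow>diag_mat C. a ^ k)"
    using w(5) by (simp add: diag_mat_def comp_def interv_sum_list_conv_sum_set_nat atLeast0LessThan)
  finally show ?thesis using C(3) by simp
qed

text \<open>With the factorised characteristic polynomial this turns \<open>det (1 - A)\<close> into
  the product of \<open>1 - a\<close> over the eigenvalues \<open>a\<close>.\<close>

lemma poly_char_poly_one:
  fixes A :: "'a :: field mat"
  assumes A: "A \<in> carrier_mat n n"
  shows "poly (char_poly A) 1 = det (1\<^sub>m n - A)"
proof -
  have "- char_matrix A 1 = 1\<^sub>m n - A"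
    using A by (intro eq_matI) (auto simp: char_matrix_def)
  then show ?thesis using char_poly_matrix[OF A, of 1] by simp
qed

lemma sums_sum_list:
  assumes "\<And>a. a \<in> set es \<Longrightarrow> (\<lambda>k. f a k) sums (g a)"
  shows "(\<lambda>k. \<Sum>a\<leftarrow>es. f a k) sums (\<Sum>a\<leftarrow>es. (g a :: 'a :: real_normed_vector))"
  using assms by (induction es) (auto intro!: sums_add)

lemma exp_sum_list: "exp (\<Sum>a\<leftarrow>es. f a) = (\<Prod>a\<leftarrow>es. exp (f a :: complex))"
  by (induction es) (auto simp: exp_add)

section \<open>Logarithmic trace expansion for nonnegative matrices\<close>

lemma pow_mat_nonneg:
  fixes B :: "'a :: linordered_semidom mat"
  assumes B: "B \<in> carrier_mat n n" "\<And>i j. i < n \<Longrightarrow> j < n \<Longrightarrow> B $$ (i, j) \<ge> 0"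
  shows "i < n \<Longrightarrow> j < n \<Longrightarrow> (B ^\<^sub>m k) $$ (i, j) \<ge> 0"
proof (induction k arbitrary: i j)
  case 0
  then show ?case using B(1) by auto
next
  case (Suc k)
  have "(B ^\<^sub>m Suc k) $$ (i, j) = (\<Sum>l\<in>{0..<n}. (B ^\<^sub>m k) $$ (i, l) * B $$ (l, j))"
    using Suc.prems B(1) pow_carrier_mat[OF B(1), of k] by (auto simp: scalar_prod_def)
  then show ?case using Suc B(2) by (auto intro!: sum_nonneg)
qed

lemma pow_mat_of_real:
  assumes "B \<in> carrier_mat n n"
  shows "map_mat complex_of_real B ^\<^sub>m k = map_mat complex_of_real (B ^\<^sub>m k)"
  by (rule of_real_hom.mat_hom_pow[OF assms, symmetric])

text \<open>This is \<open>ln s \<le> s - 1\<close> at \<open>s = 1 / (1 - t)\<close>. It brings the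
  logarithm series without its linear term into the shape of the final bound.\<close>

lemma ln_one_minus_ge:
  fixes t :: real
  assumes "0 \<le> t" "t < 1"
  shows "- ln (1 - t) - t \<le> - t * ln (1 - t)"
proof -
  have "ln (1 / (1 - t)) \<le> 1 / (1 - t) - 1"
    using assms by (intro ln_le_minus_one) auto
  then have "- ln (1 - t) \<le> t / (1 - t)" using assms by (simp add: ln_div field_simps)
  then have "- ln (1 - t) * (1 - t) \<le> t" using assms by (simp add: pos_le_divide_eq)
  then show ?thesis by (simp add: algebra_simps)
qed

proposition det_one_minus_nonneg_bounds:
  fixes B :: "real mat"
  assumes B: "B \<in> carrier_mat n n" and n: "n > 0"
    and nonneg: "\<And>i j. i < n \<Longrightarrow> j < n \<Longrightarrow> B $$ (i, j) \<ge> 0"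
    and diag: "\<And>i. i < n \<Longrightarrow> B $$ (i, i) = 0"
    and rho: "spectral_radius (map_mat complex_of_real B) < 1"
  defines "\<rho> \<equiv> spectral_radius (map_mat complex_of_real B)"
  shows "det (1\<^sub>m n - B) > 0" and "ln (det (1\<^sub>m n - B)) \<le> 0"
    and "- ln (det (1\<^sub>m n - B)) \<le> - real n * \<rho> * ln (1 - \<rho>)"
proof -
  let ?C = "map_mat complex_of_real B"
  have C: "?C \<in> carrier_mat n n" using B by auto
  obtain es where es: "char_poly ?C = (\<Prod>a\<leftarrow>es. [:- a, 1:])" "length es = n"
    using char_poly_factorized[OF C] by blast
  have le_\<rho>: "cmod a \<le> \<rho>" if "a \<in> set es" for a
  proof -
    have "a \<in> spectrum ?C"
      unfolding spectrum_root_char_poly[OF C] es(1) using linear_poly_root[OF that] by simp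
    then show ?thesis unfolding \<rho>_def by (intro spectral_radius_mem_max(2)[OF C n]) auto
  qed
  have "0 \<le> \<rho>"
  proof -
    have "es \<noteq> []" using es(2) n by auto
    then show ?thesis using le_\<rho>[of "hd es"] norm_ge_zero[of "hd es"]
      by (meson hd_in_set order_trans)
  qed
  have "\<rho> < 1" using rho by (simp add: \<rho>_def)
  \<comment> \<open>Division by zero makes \<open>t 0 = 0\<close>, so the series may start at index
    0; the logarithm series below follow the same convention.\<close>
  define t where "t k = (\<Sum>i<n. (B ^\<^sub>m k) $$ (i, i)) / real k" for k
  have trace: "complex_of_real (\<Sum>i<n. (B ^\<^sub>m k) $$ (i, i)) = (\<Sum>a\<leftarrow>es. a ^ k)" for k
    using trace_pow_eq_sum_eigenvalues[OF C es(1), of k] B by (simp add: pow_mat_of_real[OF B])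
  \<comment> \<open>The series of \<open>Ln (1 + s)\<close> is taken at \<open>s = - a\<close>,
    inside the unit disc because \<open>cmod a \<le> \<rho> < 1\<close>.\<close>
  have "(\<lambda>k. \<Sum>a\<leftarrow>es. - (a ^ k) / of_nat k) sums (\<Sum>a\<leftarrow>es. Ln (1 - a))"
    using Ln_series'[of "- a" for a] le_\<rho> \<open>\<rho> < 1\<close> by (intro sums_sum_list) fastforce
  moreover have "(\<Sum>a\<leftarrow>es. - (a ^ k) / of_nat k) = complex_of_real (- t k)" for k
  proof -
    have "(\<Sum>a\<leftarrow>es. - (a ^ k) / of_nat k) = - (\<Sum>a\<leftarrow>es. a ^ k) / of_nat k"
      by (induction es) (auto simp: diff_divide_distrib add_divide_distrib)
    then show ?thesis by (simp add: t_def trace[symmetric])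
  qed
  ultimately have sumsL: "(\<lambda>k. complex_of_real (- t k)) sums (\<Sum>a\<leftarrow>es. Ln (1 - a))"
    by simp
  define S where "S = - Re (\<Sum>a\<leftarrow>es. Ln (1 - a))"
  have S: "t sums S"
    using sums_minus[OF sums_Re[OF sumsL]] by (simp add: S_def)
  \<comment> \<open>All terms are real, so the sum of the principal logarithms is real and equals
    its real part.\<close>
  have "(\<lambda>k. complex_of_real (- t k)) sums complex_of_real (- S)"
    using S by (intro sums_of_real sums_minus)
  with sumsL have SL: "(\<Sum>a\<leftarrow>es. Ln (1 - a)) = complex_of_real (- S)"
    by (rule sums_unique2)
  have "complex_of_real (det (1\<^sub>m n - B)) = det (1\<^sub>m n - ?C)"
  proof -
    have "map_mat complex_of_real (1\<^sub>m n - B) = 1\<^sub>m n - ?C"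
      using B by (intro eq_matI) auto
    then show ?thesis by (simp flip: of_real_hom.hom_det)
  qed
  also have "\<dots> = poly (\<Prod>a\<leftarrow>es. [:- a, 1:]) 1"
    using poly_char_poly_one[OF C] es by simp
  also have "\<dots> = (\<Prod>a\<leftarrow>es. 1 - a)"
    by (simp add: poly_prod_list comp_def)
  also have "\<dots> = (\<Prod>a\<leftarrow>es. exp (Ln (1 - a)))"
  proof -
    have "1 - a = exp (Ln (1 - a))" if "a \<in> set es" for a
      using le_\<rho>[OF that] \<open>\<rho> < 1\<close> by (cases "a = 1") auto
    then show ?thesis by (simp cong: map_cong)
  qed
  also have "\<dots> = complex_of_real (exp (- S))"
    by (simp only: exp_sum_list[symmetric] SL exp_of_real)
  finally have det: "det (1\<^sub>m n - B) = exp (- S)" by (simp only: of_real_eq_iff)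
  then show "det (1\<^sub>m n - B) > 0" by simp
  have "t k \<ge> 0" for k
    unfolding t_def using pow_mat_nonneg[OF B nonneg] by (auto intro!: divide_nonneg_nonneg sum_nonneg)
  then have "S \<ge> 0" using S sums_le[of "\<lambda>_. 0" t 0 S] by auto
  then show "ln (det (1\<^sub>m n - B)) \<le> 0" using det by simp
  have "(\<lambda>k. \<rho> ^ k / real k) sums (- ln (1 - \<rho>))"
    using sums_minus[OF ln_series'[of "- \<rho>"]] \<open>0 \<le> \<rho>\<close> \<open>\<rho> < 1\<close> by simp
  \<comment> \<open>The trace of \<open>B\<close> is zero, so the dominating series may drop its
    linear term; this is what leaves \<open>- ln (1 - \<rho>) - \<rho>\<close>.\<close>
  moreover have "(\<lambda>k. if k = 1 then \<rho> else 0) sums \<rho>" by (rule sums_single)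
  ultimately have bound: "(\<lambda>k. real n * (\<rho> ^ k / real k - (if k = 1 then \<rho> else 0)))
      sums (real n * (- ln (1 - \<rho>) - \<rho>))"
    by (intro sums_mult sums_diff)
  have "t k \<le> real n * (\<rho> ^ k / real k - (if k = 1 then \<rho> else 0))" for k
  proof (cases "k = 1")
    case True
    have "B ^\<^sub>m 1 = B" using B by simp
    then show ?thesis using True diag by (simp add: t_def)
  next
    case False
    \<comment> \<open>Triangle inequality over the \<open>n\<close> eigenvalues, counted with
      multiplicity.\<close>
    have "norm (\<Sum>a\<leftarrow>es. a ^ k) \<le> (\<Sum>a\<leftarrow>es. \<rho> ^ k)" using le_\<rho>
      by (induction es) (auto intro!: order_trans[OF norm_triangle_ineq] add_mono power_mono
        simp: norm_power)
    also have "\<dots> = real n * \<rho> ^ k" using es(2) by (simp add: sum_list_triv)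
    finally have "(\<Sum>i<n. (B ^\<^sub>m k) $$ (i, i)) \<le> real n * \<rho> ^ k"
      unfolding trace[symmetric] norm_of_real by simp
    then show ?thesis using False by (auto simp: t_def divide_right_mono)
  qed
  then have "S \<le> real n * (- ln (1 - \<rho>) - \<rho>)" by (rule sums_le[OF _ S bound])
  also have "\<dots> \<le> real n * (- \<rho> * ln (1 - \<rho>))"
    using ln_one_minus_ge[OF \<open>0 \<le> \<rho>\<close> \<open>\<rho> < 1\<close>] by (intro mult_left_mono) auto
  finally show "- ln (det (1\<^sub>m n - B)) \<le> - real n * \<rho> * ln (1 - \<rho>)" using det by simp
qed

section \<open>M-matrices\<close>

definition Z_matrix :: "nat \<Rightarrow> real mat \<Rightarrow> bool" where
  "Z_matrix n M \<longleftrightarrow> M \<in> carrier_mat n n \<and> (\<forall>i<n. \<forall>j<n. i \<noteq> j \<longrightarrow> M $$ (i, j) \<le> 0)"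

text \<open>Among Z-matrices this singles out the nonsingular M-matrices. Strictness lets a witness
  \<open>w\<close> survive small changes of \<open>M\<close>.\<close>

definition semipositive :: "nat \<Rightarrow> real mat \<Rightarrow> bool" where
  "semipositive n M \<longleftrightarrow> (\<exists>w. \<forall>i<n. w i > 0 \<and> (\<Sum>j<n. M $$ (i, j) * w j) > 0)"

lemma mult_mat_vec_entry:
  "M \<in> carrier_mat m n \<Longrightarrow> y \<in> carrier_vec n \<Longrightarrow> i < m \<Longrightarrow>
    (M *\<^sub>v y) $ i = (\<Sum>j<n. M $$ (i, j) * y $ j)"
  by (auto simp: scalar_prod_def atLeast0LessThan)

text \<open>Let \<open>c\<close> be the least ratio \<open>y $ i / w i\<close>, attained at
  \<open>m\<close>. If \<open>c < 0\<close>, then \<open>y - c w\<close> is nonnegative and vanishes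
  at \<open>m\<close>, so the sign pattern makes row \<open>m\<close> of \<open>M (y - c w)\<close>
  nonpositive. But that row is \<open>M y\<close> minus the negative number \<open>c\<close> times
  the positive \<open>M w\<close>, hence positive.\<close>

lemma semipositive_monotone:
  assumes M: "Z_matrix n M" "semipositive n M"
    and y: "y \<in> carrier_vec n" "\<And>i. i < n \<Longrightarrow> (M *\<^sub>v y) $ i \<ge> 0"
    and k: "k < n"
  shows "y $ k \<ge> 0"
proof (rule ccontr)
  assume neg: "\<not> y $ k \<ge> 0"
  have carr: "M \<in> carrier_mat n n" using M(1) by (simp add: Z_matrix_def)
  obtain w where w: "\<And>i. i < n \<Longrightarrow> w i > 0" "\<And>i. i < n \<Longrightarrow> (\<Sum>j<n. M $$ (i, j) * w j) > 0"
    using M(2) unfolding semipositive_def by blast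
  define c where "c = Min ((\<lambda>i. y $ i / w i) ` {..<n})"
  have c_le: "c \<le> y $ i / w i" if "i < n" for i
    using that unfolding c_def by auto
  have "c \<in> (\<lambda>i. y $ i / w i) ` {..<n}" using k unfolding c_def by (intro Min_in) auto
  then obtain m where m: "m < n" "c = y $ m / w m" by auto
  have "c < 0" using c_le[OF k] neg w(1)[OF k] by (smt (verit) divide_neg_pos)
  have ge: "y $ i - c * w i \<ge> 0" if "i < n" for i
    using c_le[OF that] w(1)[OF that] by (simp add: field_simps)
  have zero: "y $ m - c * w m = 0" using m w(1)[OF m(1)] by simp
  have "M $$ (m, j) * (y $ j - c * w j) \<le> 0" if "j < n" for j
  proof (cases "j = m")
    case True
    then show ?thesis using zero by simp
  next
    case False
    then have "M $$ (m, j) \<le> 0" using M(1) m(1) that by (auto simp: Z_matrix_def)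
    then show ?thesis using ge[OF that] by (rule mult_nonpos_nonneg)
  qed
  then have "(\<Sum>j<n. M $$ (m, j) * (y $ j - c * w j)) \<le> 0" by (intro sum_nonpos) auto
  also have "(\<Sum>j<n. M $$ (m, j) * (y $ j - c * w j))
      = (M *\<^sub>v y) $ m - c * (\<Sum>j<n. M $$ (m, j) * w j)"
    unfolding mult_mat_vec_entry[OF carr y(1) m(1)]
    by (simp add: right_diff_distrib sum_subtractf sum_distrib_left mult.left_commute)
  finally show False
    using y(2)[OF m(1)] mult_neg_pos[OF \<open>c < 0\<close> w(2)[OF m(1)]] by linarith
qed

text \<open>Cramer's rule without a quotient: for a fixed right-hand side \<open>M y\<close> the
  left side is a polynomial in the entries of \<open>M\<close>, and for
  \<open>det M \<noteq> 0\<close> it has the sign of \<open>y $ k\<close>.\<close>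

lemma cramer_sign:
  assumes M: "M \<in> carrier_mat n n" and y: "y \<in> carrier_vec n" and k: "k < n"
  shows "det (replace_col M (M *\<^sub>v y) k) * det M = y $ k * (det M)\<^sup>2"
  using cramer_lemma_mat[OF M y k] by (simp add: power2_eq_square)

text \<open>The sign condition on the Cramer determinants says that the solution of
  \<open>M y = (1, \<dots>, 1)\<close> is nonnegative.\<close>

lemma semipositive_iff_cramer:
  assumes Z: "Z_matrix n M" and det: "det M \<noteq> 0"
  shows "semipositive n M \<longleftrightarrow> (\<forall>k<n. det (replace_col M (vec n (\<lambda>_. 1)) k) * det M \<ge> 0)"
proof -
  have carr: "M \<in> carrier_mat n n" using Z by (simp add: Z_matrix_def)
  obtain N where N: "N \<in> carrier_mat n n" "M * N = 1\<^sub>m n"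
    using det_non_zero_imp_unit[OF carr det, of "()"] by (auto simp: Units_def ring_mat_def)
  define y where "y = N *\<^sub>v vec n (\<lambda>_. 1)"
  have y: "y \<in> carrier_vec n" using N by (auto simp: y_def)
  have My: "M *\<^sub>v y = vec n (\<lambda>_. 1)"
    unfolding y_def using carr N by (subst assoc_mult_mat_vec[symmetric]) auto
  have sgn: "det (replace_col M (vec n (\<lambda>_. 1)) k) * det M \<ge> 0 \<longleftrightarrow> y $ k \<ge> 0" if "k < n" for k
    using cramer_sign[OF carr y that] det My by (simp add: zero_le_mult_iff)
  have "semipositive n M \<longleftrightarrow> (\<forall>k<n. y $ k \<ge> 0)"
  proof
    assume "semipositive n M"
    then show "\<forall>k<n. y $ k \<ge> 0" using semipositive_monotone[OF Z _ y] My by simp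
  next
    assume nonneg: "\<forall>k<n. y $ k \<ge> 0"
    have row: "(\<Sum>j<n. M $$ (i, j) * y $ j) = 1" if "i < n" for i
      using mult_mat_vec_entry[OF carr y that] My that by simp
    \<comment> \<open>A zero entry \<open>y $ i\<close> would make every term of row
      \<open>i\<close> nonpositive, although the row sums to 1. So \<open>y\<close> is positive and
      is itself the witness.\<close>
    have "y $ i \<noteq> 0" if "i < n" for i
    proof
      assume "y $ i = 0"
      have "M $$ (i, j) * y $ j \<le> 0" if "j < n" for j
      proof (cases "j = i")
        case False
        then show ?thesis
          using Z nonneg \<open>i < n\<close> that by (auto simp: Z_matrix_def intro!: mult_nonpos_nonneg)
      qed (simp add: \<open>y $ i = 0\<close>)
      then have "(\<Sum>j<n. M $$ (i, j) * y $ j) \<le> 0" by (intro sum_nonpos) auto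
      then show False using row[OF that] by simp
    qed
    then show "semipositive n M"
      unfolding semipositive_def using nonneg row
      by (intro exI[of _ "\<lambda>i. y $ i"]) (auto simp: order_less_le)
  qed
  then show ?thesis using sgn by auto
qed

section \<open>Inverses, spectral radii and the bounds on the indices\<close>

lemma mat_inv_eqI:
  assumes A: "A \<in> carrier_mat n n" and B: "B \<in> carrier_mat n n" and AB: "A * B = 1\<^sub>m n"
  shows "mat_inv A = B"
proof (cases "mat_inverse A")
  case None
  \<comment> \<open>A right inverse of a square matrix is two-sided, so \<open>A\<close> is a unit
    and the case where \<open>mat_inv\<close> is unspecified cannot occur.\<close>
  have "A \<in> Units (ring_mat TYPE(real) n ())"
    using A B AB mat_mult_left_right_inverse[OF A B AB] by (auto simp: Units_def ring_mat_def)
  then show ?thesis using mat_inverse(1)[OF A None, of "()"] by simp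
next
  case (Some C)
  note C = mat_inverse(2)[OF A Some]
  have "C = C * (A * B)" using C AB by auto
  also have "\<dots> = (C * A) * B" using A B C by (intro assoc_mult_mat[symmetric]) auto
  also have "\<dots> = B" using C B by auto
  finally show ?thesis using Some by (simp add: mat_inv_def)
qed

lemma spectrum_uminus:
  assumes "(A :: complex mat) \<in> carrier_mat n n"
  shows "spectrum (- A) = uminus ` spectrum A"
proof -
  have *: "eigenvalue (- A) (- k)" if ev: "eigenvalue A k" and carr: "A \<in> carrier_mat n n" for A :: "complex mat" and k
  proof -
    obtain v where v: "v \<in> carrier_vec n" "v \<noteq> 0\<^sub>v n" "A *\<^sub>v v = k \<cdot>\<^sub>v v"
      using ev carr unfolding eigenvalue_def eigenvector_def by auto
    have "(- A) *\<^sub>v v = (- k) \<cdot>\<^sub>v v"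
      using v carr by (subst uminus_mult_mat_vec) auto
    then show ?thesis
      using v carr unfolding eigenvalue_def eigenvector_def by (intro exI[of _ v]) auto
  qed
  have "k \<in> uminus ` spectrum A" if "k \<in> spectrum (- A)" for k
    \<comment> \<open>The converse inclusion is the first one applied to \<open>- A\<close>.\<close>
    using *[of "- A" k] assms that unfolding spectrum_def by (force simp: image_iff)
  then show ?thesis using *[OF _ assms] unfolding spectrum_def by auto
qed

text \<open>The index \<open>rho\<close> is formed from the matrix \<open>- B\<close>, whereas the
  estimates concern the nonnegative \<open>B\<close>.\<close>

lemma spectral_radius_uminus:
  assumes "(A :: complex mat) \<in> carrier_mat n n"
  shows "spectral_radius (- A) = spectral_radius A"
  unfolding spectral_radius_def spectrum_uminus[OF assms] image_image by simp

text \<open>In the maximum norm weighted by \<open>w\<close>, the matrix \<open>B\<close> is a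
  strict contraction. Concretely, the equation of a dominant eigenvector is read in the row where
  \<open>cmod (y $ i) / w i\<close> is largest.\<close>

lemma spectral_radius_nonneg_less_one:
  fixes B :: "real mat"
  assumes B: "B \<in> carrier_mat n n" and n: "n > 0"
    and nonneg: "\<And>i j. i < n \<Longrightarrow> j < n \<Longrightarrow> B $$ (i, j) \<ge> 0"
    and w: "\<And>i. i < n \<Longrightarrow> w i > 0" "\<And>i. i < n \<Longrightarrow> (\<Sum>j<n. B $$ (i, j) * w j) < w i"
  shows "spectral_radius (map_mat complex_of_real B) < 1"
proof -
  let ?C = "map_mat complex_of_real B"
  have C: "?C \<in> carrier_mat n n" using B by auto
  obtain k where k: "k \<in> spectrum ?C" "spectral_radius ?C = cmod k"
    using spectral_radius_mem_max(1)[OF C n] by auto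
  obtain y where y: "y \<in> carrier_vec n" "y \<noteq> 0\<^sub>v n" "?C *\<^sub>v y = k \<cdot>\<^sub>v y"
    using k(1) C unfolding spectrum_def eigenvalue_def eigenvector_def by auto
  define c where "c = Max ((\<lambda>i. cmod (y $ i) / w i) ` {..<n})"
  have le_c: "cmod (y $ i) / w i \<le> c" if "i < n" for i
    using that unfolding c_def by (intro Max_ge) auto
  have "c \<in> (\<lambda>i. cmod (y $ i) / w i) ` {..<n}" using n unfolding c_def by (intro Max_in) auto
  then obtain m where m: "m < n" "c = cmod (y $ m) / w m" by auto
  obtain l where "l < n" "y $ l \<noteq> 0" using y(1,2) by (metis carrier_vecD eq_vecI index_zero_vec)
  then have "0 < cmod (y $ l) / w l" using w(1) by simp
  then have "c > 0" using le_c[OF \<open>l < n\<close>] by linarith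
  have "k * y $ m = (\<Sum>j<n. complex_of_real (B $$ (m, j)) * y $ j)"
    using mult_mat_vec_entry[OF C y(1) m(1)] y m(1) B by simp
  then have "cmod k * cmod (y $ m) \<le> (\<Sum>j<n. B $$ (m, j) * cmod (y $ j))"
    unfolding norm_mult[symmetric] using nonneg m(1)
    by (auto intro!: sum_norm_le simp: norm_mult)
  also have "\<dots> \<le> (\<Sum>j<n. B $$ (m, j) * (c * w j))"
    using le_c w(1) nonneg m(1) by (intro sum_mono mult_left_mono) (auto simp: pos_divide_le_eq)
  also have "\<dots> = c * (\<Sum>j<n. B $$ (m, j) * w j)"
    by (simp add: sum_distrib_left mult.left_commute)
  also have "\<dots> < c * w m" using w(2)[OF m(1)] \<open>c > 0\<close> by simp
  also have "\<dots> = cmod (y $ m)" using m w(1)[OF m(1)] by simp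
  finally have "cmod k < 1"
    using mult_right_mono[of 1 "cmod k" "cmod (y $ m)"] by force
  then show ?thesis using k(2) by simp
qed

text \<open>Dividing the row inequalities \<open>M w > 0\<close> by the diagonal gives
  \<open>B w < w\<close>, hence spectral radius below 1. Logarithms of
  \<open>det M = det D * det (1 - B)\<close> identify \<open>VSI M - AVSI M\<close> with
  \<open>ln (det (1 - B)) / n\<close>.\<close>

proposition VSI_AVSI_bounds:
  assumes Z: "Z_matrix n M" and sp: "semipositive n M" and n: "n > 0"
  shows "det M > 0" and "\<forall>j<n. M $$ (j, j) > 0" and "rho M < 1"
    and "VSI M \<le> AVSI M" and "AVSI M \<le> VSI M - rho M * ln (1 - rho M)"
proof -
  have M: "M \<in> carrier_mat n n" using Z by (simp add: Z_matrix_def)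
  obtain w where w: "\<And>i. i < n \<Longrightarrow> w i > 0" "\<And>i. i < n \<Longrightarrow> (\<Sum>j<n. M $$ (i, j) * w j) > 0"
    using sp unfolding semipositive_def by blast
  \<comment> \<open>The Jacobi iteration matrix: \<open>1 - B\<close> is \<open>M\<close> with each
    row divided by its diagonal entry.\<close>
  define B where "B = mat n n (\<lambda>(i, j). if i = j then 0 else - M $$ (i, j) / M $$ (i, i))"
  have B: "B \<in> carrier_mat n n" by (simp add: B_def)
  have split: "(\<Sum>j<n. M $$ (i, j) * w j)
      = M $$ (i, i) * w i + (\<Sum>j\<in>{..<n} - {i}. M $$ (i, j) * w j)" if "i < n" for i
    using that by (subst sum.remove[of _ i]) auto
  have off: "(\<Sum>j\<in>{..<n} - {i}. M $$ (i, j) * w j) \<le> 0" if "i < n" for i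
    using that Z w(1) by (intro sum_nonpos) (auto simp: Z_matrix_def less_imp_le intro!: mult_nonpos_nonneg)
  have diag: "M $$ (i, i) > 0" if "i < n" for i
  proof -
    have "M $$ (i, i) * w i > 0" using w(2)[OF that] split[OF that] off[OF that] by linarith
    then show ?thesis using w(1)[OF that] by (simp add: zero_less_mult_iff)
  qed
  then show "\<forall>j<n. M $$ (j, j) > 0" by simp
  have nonneg: "B $$ (i, j) \<ge> 0" if "i < n" "j < n" for i j
    using that Z diag by (auto simp: B_def Z_matrix_def intro!: divide_nonpos_pos)
  have row: "(\<Sum>j<n. B $$ (i, j) * w j) < w i" if "i < n" for i
  proof -
    have "(\<Sum>j<n. B $$ (i, j) * w j) = (\<Sum>j\<in>{..<n} - {i}. B $$ (i, j) * w j)"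
      using that by (intro sum.mono_neutral_right) (auto simp: B_def)
    also have "\<dots> = - (\<Sum>j\<in>{..<n} - {i}. M $$ (i, j) * w j) / M $$ (i, i)"
      using that unfolding sum_negf[symmetric] sum_divide_distrib by (intro sum.cong) (auto simp: B_def)
    also have "\<dots> < w i"
      using w(2)[OF that] split[OF that] diag[OF that]
      by (subst pos_divide_less_eq) (simp_all add: mult.commute)
    finally show ?thesis .
  qed
  have rB: "spectral_radius (map_mat complex_of_real B) < 1"
    by (rule spectral_radius_nonneg_less_one[where w = w, OF B n nonneg w(1) row])
  have "mat_inv (diag_part M) = mat_diag n (\<lambda>j. 1 / M $$ (j, j))"
  proof (rule mat_inv_eqI)
    show "diag_part M * mat_diag n (\<lambda>j. 1 / M $$ (j, j)) = 1\<^sub>m n"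
    proof -
      have "diag_part M = mat_diag n (\<lambda>j. M $$ (j, j))" using M by (simp add: diag_part_def)
      then have "diag_part M * mat_diag n (\<lambda>j. 1 / M $$ (j, j))
          = mat_diag n (\<lambda>j. M $$ (j, j) * (1 / M $$ (j, j)))"
        by (simp only: mat_diag_diag)
      also have "\<dots> = 1\<^sub>m n"
        using diag by (intro eq_matI) (auto simp: mat_diag_def less_imp_neq[symmetric])
      finally show ?thesis .
    qed
  qed (use M in \<open>auto simp: diag_part_def\<close>)
  then have "mat_inv (diag_part M) * off_part M = mat n n (\<lambda>(i, j). 1 / M $$ (i, i) * off_part M $$ (i, j))"
    using M by (subst mat_diag_mult_left[symmetric]) (auto simp: off_part_def diag_part_def intro!: minus_carrier_mat)
  also have "\<dots> = - B"
    using M by (intro eq_matI) (auto simp: off_part_def diag_part_def mat_diag_def B_def)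
  finally have "map_mat complex_of_real (mat_inv (diag_part M) * off_part M)
      = - map_mat complex_of_real B"
    using B by (intro eq_matI) auto
  then have rho: "rho M = spectral_radius (map_mat complex_of_real B)"
    unfolding rho_def using B by (subst spectral_radius_uminus[symmetric, of _ n]) auto
  then show "rho M < 1" using rB by simp
  note bounds = det_one_minus_nonneg_bounds[OF B n nonneg _ rB, folded rho]
  have B0: "B $$ (i, i) = 0" if "i < n" for i using that by (simp add: B_def)
  define D where "D = mat_diag n (\<lambda>j. M $$ (j, j))"
  have D: "D \<in> carrier_mat n n" by (simp add: D_def)
  have "M = D * (1\<^sub>m n - B)"
    unfolding D_def using M
    by (subst mat_diag_mult_left[of _ _ n])
      (auto simp: B_def less_imp_neq[OF diag, symmetric] intro!: eq_matI minus_carrier_mat)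
  then have "det M = det D * det (1\<^sub>m n - B)" using det_mult[OF D minus_carrier_mat[OF B]] by metis
  also have "det D = (\<Prod>j<n. M $$ (j, j))"
    by (subst det_upper_triangular[of _ n])
      (auto simp: D_def mat_diag_def upper_triangular_def prod_list_diag_prod atLeast0LessThan)
  finally have det: "det M = (\<Prod>j<n. M $$ (j, j)) * det (1\<^sub>m n - B)" .
  have pos: "(\<Prod>j<n. M $$ (j, j)) > 0" using diag by (intro prod_pos) auto
  have dpos: "det (1\<^sub>m n - B) > 0" using bounds(1) B0 by blast
  show "det M > 0" unfolding det using pos dpos by simp
  have "ln (det M) = ln (\<Prod>j<n. M $$ (j, j)) + ln (det (1\<^sub>m n - B))"
    unfolding det using pos dpos by (rule ln_mult_pos)
  then have VSI: "VSI M = AVSI M + ln (det (1\<^sub>m n - B)) / real n"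
    using M by (simp add: VSI_def AVSI_def add_divide_distrib)
  show "VSI M \<le> AVSI M"
    using VSI bounds(2) B0 n by (simp add: divide_nonpos_pos)
  have "- ln (det (1\<^sub>m n - B)) / real n \<le> - rho M * ln (1 - rho M)"
    using bounds(3) B0 n by (simp add: field_simps)
  then show "AVSI M \<le> VSI M - rho M * ln (1 - rho M)" using VSI by simp
qed

section \<open>The Jacobians of the branch flow model\<close>

lemma append_cols_carrier:
  "M \<in> carrier_mat m a \<Longrightarrow> M' \<in> carrier_mat m b \<Longrightarrow> M @\<^sub>c M' \<in> carrier_mat m (a + b)"
  unfolding append_cols_def using four_block_carrier_mat[of M m a "0\<^sub>m 0 b" 0 b] by fastforce

lemma append_cols_mult_vec:
  fixes M :: "'a :: semiring_0 mat"
  assumes "M \<in> carrier_mat m a" "M' \<in> carrier_mat m b" "y \<in> carrier_vec a" "y' \<in> carrier_vec b"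
  shows "(M @\<^sub>c M') *\<^sub>v (y @\<^sub>v y') = M *\<^sub>v y + M' *\<^sub>v y'"
  unfolding append_cols_def using assms
  by (subst four_block_mat_mult_vec[of _ m a _ b _ 0]) auto

text \<open>Six blocks, associated to the right, match each block row of the full Jacobian.\<close>

lemma append_cols6_mult_vec:
  fixes M1 :: "'a :: semiring_0 mat"
  assumes M: "M1 \<in> carrier_mat m a1" "M2 \<in> carrier_mat m a2" "M3 \<in> carrier_mat m a3"
      "M4 \<in> carrier_mat m a4" "M5 \<in> carrier_mat m a5" "M6 \<in> carrier_mat m a6"
    and y: "y1 \<in> carrier_vec a1" "y2 \<in> carrier_vec a2" "y3 \<in> carrier_vec a3"
      "y4 \<in> carrier_vec a4" "y5 \<in> carrier_vec a5" "y6 \<in> carrier_vec a6"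
  shows "M1 @\<^sub>c M2 @\<^sub>c M3 @\<^sub>c M4 @\<^sub>c M5 @\<^sub>c M6 \<in> carrier_mat m (a1 + (a2 + (a3 + (a4 + (a5 + a6)))))"
    and "(M1 @\<^sub>c M2 @\<^sub>c M3 @\<^sub>c M4 @\<^sub>c M5 @\<^sub>c M6) *\<^sub>v (y1 @\<^sub>v y2 @\<^sub>v y3 @\<^sub>v y4 @\<^sub>v y5 @\<^sub>v y6)
      = M1 *\<^sub>v y1 + (M2 *\<^sub>v y2 + (M3 *\<^sub>v y3 + (M4 *\<^sub>v y4 + (M5 *\<^sub>v y5 + M6 *\<^sub>v y6))))"
proof -
  note c5 = append_cols_carrier[OF M(5,6)] and w5 = append_carrier_vec[OF y(5,6)]
  note c4 = append_cols_carrier[OF M(4) c5] and w4 = append_carrier_vec[OF y(4) w5]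
  note c3 = append_cols_carrier[OF M(3) c4] and w3 = append_carrier_vec[OF y(3) w4]
  note c2 = append_cols_carrier[OF M(2) c3] and w2 = append_carrier_vec[OF y(2) w3]
  show "M1 @\<^sub>c M2 @\<^sub>c M3 @\<^sub>c M4 @\<^sub>c M5 @\<^sub>c M6 \<in> carrier_mat m (a1 + (a2 + (a3 + (a4 + (a5 + a6)))))"
    by (rule append_cols_carrier[OF M(1) c2])
  show "(M1 @\<^sub>c M2 @\<^sub>c M3 @\<^sub>c M4 @\<^sub>c M5 @\<^sub>c M6) *\<^sub>v (y1 @\<^sub>v y2 @\<^sub>v y3 @\<^sub>v y4 @\<^sub>v y5 @\<^sub>v y6)
      = M1 *\<^sub>v y1 + (M2 *\<^sub>v y2 + (M3 *\<^sub>v y3 + (M4 *\<^sub>v y4 + (M5 *\<^sub>v y5 + M6 *\<^sub>v y6))))"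
    by (simp only: append_cols_mult_vec[OF M(1) c2 y(1) w2] append_cols_mult_vec[OF M(2) c3 y(2) w3]
      append_cols_mult_vec[OF M(3) c4 y(3) w4] append_cols_mult_vec[OF M(4) c5 y(4) w5]
      append_cols_mult_vec[OF M(5,6) y(5,6)])
qed

lemma mult_mat_vec_uminus:
  "M \<in> carrier_mat m n \<Longrightarrow> y \<in> carrier_vec n \<Longrightarrow> M *\<^sub>v (- y) = - (M *\<^sub>v (y :: 'a :: comm_ring vec))"
  by (intro eq_vecI) auto

lemma smult_mat_mult_vec:
  "M \<in> carrier_mat m n \<Longrightarrow> y \<in> carrier_vec n \<Longrightarrow> (k \<cdot>\<^sub>m M) *\<^sub>v y = (k :: 'a :: comm_semiring_0) \<cdot>\<^sub>v (M *\<^sub>v y)"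
  by (intro eq_vecI) auto

lemma linear_combination_mult_vec:
  fixes M1 M2 M3 M4 :: "'a :: comm_ring_1 mat"
  assumes "M1 \<in> carrier_mat n n" "M2 \<in> carrier_mat n n" "M3 \<in> carrier_mat n n" "M4 \<in> carrier_mat n n"
    and "y \<in> carrier_vec n"
  shows "(M1 + k \<cdot>\<^sub>m M2 + l \<cdot>\<^sub>m M3 - M4) *\<^sub>v y
    = M1 *\<^sub>v y + k \<cdot>\<^sub>v (M2 *\<^sub>v y) + l \<cdot>\<^sub>v (M3 *\<^sub>v y) - M4 *\<^sub>v y"
proof -
  have "M1 + k \<cdot>\<^sub>m M2 \<in> carrier_mat n n" "M1 + k \<cdot>\<^sub>m M2 + l \<cdot>\<^sub>m M3 \<in> carrier_mat n n"
    using assms by auto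
  then show ?thesis
    using assms by (simp only: minus_mult_distrib_mat_vec add_mult_distrib_mat_vec smult_mat_mult_vec
      smult_carrier_mat)
qed

section \<open>Incidence matrices and the power balance equations\<close>

lemma diag_of_edge_vec: "diag_of_vec (edge_vec n f) = mat_diag n (\<lambda>k. f (Suc k))"
  by (intro eq_matI) (auto simp: diag_of_vec_def edge_vec_def mat_diag_def)

lemma edge_diag_carrier: "diag_of_vec (edge_vec n f) \<in> carrier_mat n n"
  by (simp add: diag_of_edge_vec)

lemma Delta_carrier: "Delta_mat n E \<in> carrier_mat (Suc n) n"
  by (simp add: Delta_mat_def)

lemma Delta2_carrier: "Delta2_mat n E \<in> carrier_mat n n"
  by (simp add: Delta2_mat_def delete_first_row_def Delta_mat_def)

lemma Delta2_entry:
  "i < n \<Longrightarrow> k < n \<Longrightarrow> Delta2_mat n E $$ (i, k) = (if (Suc i, Suc k) \<in> E then 1 else 0)"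
  by (simp add: Delta2_mat_def delete_first_row_def Delta_mat_def)

lemma A_carrier: "A_mat n E \<in> carrier_mat (Suc n) n"
  by (auto simp: A_mat_def Pi_mat_def Delta_mat_def intro!: minus_carrier_mat)

lemma A2_carrier: "A2_mat n E \<in> carrier_mat n n"
  by (simp add: A2_mat_def delete_first_row_def A_mat_def Pi_mat_def)

text \<open>Edges are indexed by their child, so \<open>Pi_mat\<close> without row 0 is the
  identity.\<close>

lemma A2_eq: "A2_mat n E = Delta2_mat n E - 1\<^sub>m n"
  by (intro eq_matI)
    (auto simp: A2_mat_def Delta2_mat_def delete_first_row_def A_mat_def Pi_mat_def Delta_mat_def)

lemma Pi_mult_vec:
  assumes "w \<in> carrier_vec n"
  shows "Pi_mat n *\<^sub>v w = vec (Suc n) (\<lambda>i. if i = 0 then 0 else w $ (i - 1))"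
proof (rule eq_vecI)
  fix i assume i: "i < dim_vec (vec (Suc n) (\<lambda>i. if i = 0 then 0 else w $ (i - 1)))"
  have "(Pi_mat n *\<^sub>v w) $ i = (\<Sum>k<n. if k = i - 1 \<and> i \<noteq> 0 then w $ k else 0)"
    using i assms by (subst mult_mat_vec_entry[of _ "Suc n" n])
      (auto simp: Pi_mat_def intro!: sum.cong)
  then show "(Pi_mat n *\<^sub>v w) $ i = vec (Suc n) (\<lambda>i. if i = 0 then 0 else w $ (i - 1)) $ i"
    using i by (cases "i = 0") auto
qed (simp add: Pi_mat_def)

lemma A_mult_vec_Suc:
  assumes "w \<in> carrier_vec n" "i < n"
  shows "(A_mat n E *\<^sub>v w) $ Suc i = (A2_mat n E *\<^sub>v w) $ i"
  using assms by (subst (1 2) mult_mat_vec_entry) (auto intro: A_carrier A2_carrier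
    simp: A2_mat_def delete_first_row_def A_mat_def Pi_mat_def)

lemma mat_of_single_col_mult_vec:
  "w \<in> carrier_vec m \<Longrightarrow> mat_of_cols m [w] *\<^sub>v vec 1 (\<lambda>_. c) = (c :: 'a :: comm_semiring_1) \<cdot>\<^sub>v w"
  by (intro eq_vecI) (auto simp: scalar_prod_def mat_of_cols_def mult.commute)

text \<open>Solves one linearised power balance for the current change \<open>- y\<close>: the flow
  change \<open>d\<close> balances all nodes except the root, because \<open>A2_mat n E\<close>
  sends it to \<open>F y\<close>, and the slack injection \<open>a\<close> absorbs row 0. It serves
  active power with \<open>F = R_mat\<close> and reactive power with
  \<open>F = X_mat\<close>.\<close>

lemma power_balance_kernel:
  assumes U: "U \<in> carrier_mat n n" "A2_mat n E * U = 1\<^sub>m n"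
    and F: "F \<in> carrier_mat n n" and y: "y \<in> carrier_vec n"
  defines "d \<equiv> U *\<^sub>v (F *\<^sub>v y)"
  defines "a \<equiv> vec 1 (\<lambda>_. - (A_mat n E *\<^sub>v d) $ 0)"
  shows "(- A_mat n E) *\<^sub>v d + ((- (Pi_mat n * F)) *\<^sub>v (- y)
    + (- mat_of_cols (Suc n) [unit_vec (Suc n) 0]) *\<^sub>v a) = 0\<^sub>v (Suc n)"
proof -
  have Fy: "F *\<^sub>v y \<in> carrier_vec n" using F y by auto
  have d: "d \<in> carrier_vec n" unfolding d_def using U Fy by auto
  have A2d: "A2_mat n E *\<^sub>v d = F *\<^sub>v y"
    unfolding d_def using A2_carrier[of n E] U Fy by (subst assoc_mult_mat_vec[symmetric]) auto
  have P: "Pi_mat n \<in> carrier_mat (Suc n) n" by (simp add: Pi_mat_def)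
  have "(- (Pi_mat n * F)) *\<^sub>v (- y) = Pi_mat n *\<^sub>v (F *\<^sub>v y)"
    using P F y by (subst mult_mat_vec_uminus[of _ "Suc n" n]) auto
  moreover have "(- mat_of_cols (Suc n) [unit_vec (Suc n) 0]) *\<^sub>v a
      = - ((- (A_mat n E *\<^sub>v d) $ 0) \<cdot>\<^sub>v unit_vec (Suc n) 0)"
    unfolding a_def by (subst uminus_mult_mat_vec) (auto simp: mat_of_single_col_mult_vec simp flip: One_nat_def)
  moreover have "(- A_mat n E) *\<^sub>v d = - (A_mat n E *\<^sub>v d)"
    using A_carrier[of n E] d by (intro uminus_mult_mat_vec) auto
  moreover have "(A_mat n E *\<^sub>v d) $ Suc i = (F *\<^sub>v y) $ i" if "i < n" for i
    using A_mult_vec_Suc[OF d that, of E] A2d by simp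
  ultimately show ?thesis
    using A_carrier[of n E] Fy
    by (intro eq_vecI) (auto simp: Pi_mult_vec[OF Fy] unit_vec_def less_Suc_eq_0_disj
      simp del: index_mult_mat_vec)
qed

text \<open>The ancestor matrix \<open>T\<close>, every node counting as its own ancestor. In a tree
  it is the finite Neumann series of \<open>Delta2_mat\<close>, which explains why it inverts
  \<open>1 - Delta2_mat\<close>.\<close>

definition path_mat :: "nat \<Rightarrow> (nat \<times> nat) set \<Rightarrow> real mat" where
  "path_mat n E = mat n n (\<lambda>(i, k). if (Suc i, Suc k) \<in> E\<^sup>* then 1 else 0)"

lemma path_mat_carrier: "path_mat n E \<in> carrier_mat n n"
  by (simp add: path_mat_def)

section \<open>Tree structure and the inverse of \<open>A2_mat\<close>\<close>

locale radial_network =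
  fixes n :: nat and E :: "(nat \<times> nat) set" and r x :: "nat \<Rightarrow> real"
  assumes tree: "rooted_tree n E"
    and impedance_nonneg: "j \<in> {1..n} \<Longrightarrow> r j \<ge> 0 \<and> x j \<ge> 0"
begin

lemma edge_range: "(i, j) \<in> E \<Longrightarrow> i \<le> n \<and> 1 \<le> j \<and> j \<le> n"
  using tree unfolding rooted_tree_def by fastforce

lemma parent_unique: "(i, j) \<in> E \<Longrightarrow> (i', j) \<in> E \<Longrightarrow> i = i'"
  using tree edge_range unfolding rooted_tree_def by (metis atLeastAtMost_iff)

lemma parent_iff: "(p, j) \<in> E \<Longrightarrow> (i, j) \<in> E \<longleftrightarrow> i = p"
  using parent_unique by blast

lemma parent_exists: "j < n \<Longrightarrow> \<exists>i. (i, Suc j) \<in> E"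
  using tree[unfolded rooted_tree_def, THEN conjunct2, THEN conjunct1, THEN bspec, of "Suc j"]
  by auto

text \<open>Induction along the path from the root: nothing enters the root, and a cycle through a
  node also passes through its unique parent.\<close>

lemma acyclic_tree: "(j, j) \<notin> E\<^sup>+"
proof
  assume cycle: "(j, j) \<in> E\<^sup>+"
  have "(k, k) \<notin> E\<^sup>+" if "(0, k) \<in> E\<^sup>*" for k
    using that
  proof (induction rule: rtrancl_induct)
    case base
    then show ?case using edge_range by (auto dest!: tranclD2)
  next
    case (step i k)
    then show ?case
      using parent_unique by (metis rtrancl_into_trancl2 tranclD2)
  qed
  moreover have "(0, j) \<in> E\<^sup>*"
    using cycle tree edge_range unfolding rooted_tree_def by (metis tranclD atLeast0AtMost atMost_iff)
  ultimately show False using cycle by blast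
qed

text \<open>A nontrivial path into \<open>j\<close> ends with the edge from the parent; conversely,
  acyclicity keeps an ancestor of \<open>p\<close> distinct from \<open>j\<close>.\<close>

lemma rtrancl_parent_iff:
  assumes "(p, j) \<in> E"
  shows "(i, j) \<in> E\<^sup>* \<and> i \<noteq> j \<longleftrightarrow> (i, p) \<in> E\<^sup>*"
proof
  assume "(i, j) \<in> E\<^sup>* \<and> i \<noteq> j"
  then show "(i, p) \<in> E\<^sup>*" using parent_unique[OF assms] by (metis rtranclE)
next
  assume "(i, p) \<in> E\<^sup>*"
  then have "(i, j) \<in> E\<^sup>+" using assms by (rule rtrancl_into_trancl1)
  then show "(i, j) \<in> E\<^sup>* \<and> i \<noteq> j" using acyclic_tree by auto
qed

text \<open>Column \<open>j\<close> of \<open>Delta2_mat\<close> has its only possible one at the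
  parent, so the product asks which nodes reach the parent, i.e. are proper ancestors. Removing the
  diagonal of \<open>T\<close> gives the same.\<close>

lemma path_mat_Delta2: "path_mat n E * Delta2_mat n E = path_mat n E - 1\<^sub>m n"
proof (rule eq_matI)
  fix i j assume "i < dim_row (path_mat n E - 1\<^sub>m n)" "j < dim_col (path_mat n E - 1\<^sub>m n)"
  then have ij: "i < n" "j < n" by auto
  obtain p where p: "(p, Suc j) \<in> E" using parent_exists[OF ij(2)] by blast
  have "(path_mat n E * Delta2_mat n E) $$ (i, j)
      = (\<Sum>k<n. path_mat n E $$ (i, k) * Delta2_mat n E $$ (k, j))"
    using ij path_mat_carrier[of n E] Delta2_carrier[of n E]
    by (auto simp: scalar_prod_def atLeast0LessThan)
  also have "\<dots> = (\<Sum>k<n. if Suc k = p then (if (Suc i, p) \<in> E\<^sup>* then 1 else 0) else 0)"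
    using ij by (intro sum.cong) (auto simp: path_mat_def Delta2_entry parent_iff[OF p])
  also have "\<dots> = (if (Suc i, p) \<in> E\<^sup>* then 1 else 0)"
  proof (cases p)
    \<comment> \<open>If the parent is the root, the column of \<open>Delta2_mat\<close> is zero;
      this agrees because no other node reaches the root.\<close>
    case 0
    have "(Suc i, p) \<notin> E\<^sup>*"
    proof
      assume "(Suc i, p) \<in> E\<^sup>*"
      then show False
      proof (cases rule: rtranclE)
        case base
        then show False using 0 by simp
      next
        case (step k)
        then show False using 0 edge_range[of k p] by simp
      qed
    qed
    then show ?thesis by simp
  next
    case (Suc l)
    then have "l < n" using edge_range[OF p] by simp
    then show ?thesis using Suc by simp
  qed
  also have "\<dots> = (path_mat n E - 1\<^sub>m n) $$ (i, j)"
    using ij rtrancl_parent_iff[OF p, of "Suc i"] by (auto simp: path_mat_def)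
  finally show "(path_mat n E * Delta2_mat n E) $$ (i, j) = (path_mat n E - 1\<^sub>m n) $$ (i, j)" .
qed (use path_mat_carrier[of n E] Delta2_carrier[of n E] in auto)

lemma path_mat_inverse:
  shows "- path_mat n E * A2_mat n E = 1\<^sub>m n" and "A2_mat n E * - path_mat n E = 1\<^sub>m n"
proof -
  have "path_mat n E * A2_mat n E = path_mat n E * Delta2_mat n E - path_mat n E * 1\<^sub>m n"
    unfolding A2_eq by (rule mult_minus_distrib_mat[OF path_mat_carrier Delta2_carrier]) auto
  also have "\<dots> = - 1\<^sub>m n"
    using path_mat_carrier[of n E] by (intro eq_matI) (auto simp: path_mat_Delta2)
  finally show *: "- path_mat n E * A2_mat n E = 1\<^sub>m n"
    using path_mat_carrier[of n E] A2_carrier[of n E]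
    by (subst uminus_mult_left_mat) (auto simp: path_mat_def intro!: eq_matI)
  show "A2_mat n E * - path_mat n E = 1\<^sub>m n"
    using * path_mat_carrier[of n E] by (intro mat_mult_left_right_inverse[OF _ A2_carrier]) auto
qed

lemma uminus_path_mat_carrier: "- path_mat n E \<in> carrier_mat n n"
  by (rule uminus_carrier_mat[OF path_mat_carrier])

lemma invertible_A2: "invertible_mat (A2_mat n E)"
proof -
  have "dim_row (A2_mat n E) = n" "dim_col (A2_mat n E) = n" "dim_row (- path_mat n E) = n"
    using A2_carrier[of n E] path_mat_carrier[of n E] by auto
  then show ?thesis
    unfolding invertible_mat_def inverts_mat_def square_mat.simps
    using path_mat_inverse by (intro conjI exI[of _ "- path_mat n E"]) (simp_all only:)
qed

lemma mat_inv_A2: "mat_inv (A2_mat n E) = - path_mat n E"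
  by (rule mat_inv_eqI[OF A2_carrier uminus_path_mat_carrier path_mat_inverse(2)])

lemma A2_transpose_inverse: "(A2_mat n E)\<^sup>T * (- path_mat n E)\<^sup>T = 1\<^sub>m n"
  using transpose_mult[OF uminus_path_mat_carrier A2_carrier[of n E]]
  unfolding path_mat_inverse(1) by simp

lemma mat_inv_A2_transpose: "mat_inv ((A2_mat n E)\<^sup>T) = (- path_mat n E)\<^sup>T"
  by (rule mat_inv_eqI[OF _ _ A2_transpose_inverse])
    (simp_all only: transpose_carrier_mat A2_carrier uminus_path_mat_carrier)

section \<open>Sign pattern of the reduced Jacobian\<close>

definition R_mat :: "real mat" where "R_mat = diag_of_vec (edge_vec n r)"
definition X_mat :: "real mat" where "X_mat = diag_of_vec (edge_vec n x)"

text \<open>The bracketed last factor of the reduced Jacobian, with \<open>- T\<close> for the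
  inverse of \<open>A2_mat\<close>.\<close>

definition W_mat :: "real mat" where
  "W_mat = R_mat * R_mat + 2 \<cdot>\<^sub>m (R_mat * - path_mat n E * R_mat)
    + X_mat * X_mat + 2 \<cdot>\<^sub>m (X_mat * - path_mat n E * X_mat)"

text \<open>The matrix that \<open>[L]\<close> multiplies in the reduced Jacobian:
  \<open>T * Delta2_mat = T - 1\<close> collapses the two transposed factors before
  \<open>W_mat\<close> to \<open>(1 - T)\<close> transposed.\<close>

definition K_mat :: "real mat" where
  "K_mat = (1\<^sub>m n - path_mat n E)\<^sup>T * W_mat"

lemma R_carrier: "R_mat \<in> carrier_mat n n" and X_carrier: "X_mat \<in> carrier_mat n n"
  by (simp_all add: R_mat_def X_mat_def edge_diag_carrier)

lemma W_carrier: "W_mat \<in> carrier_mat n n"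
  unfolding W_mat_def
  by (intro add_carrier_mat smult_carrier_mat mult_carrier_mat[where n = n] X_carrier
    uminus_path_mat_carrier)

lemma diag_mult_entry:
  assumes "M \<in> carrier_mat n n" "j < n" "m < n"
  shows "(diag_of_vec (edge_vec n f) * M * diag_of_vec (edge_vec n g)) $$ (j, m)
    = f (Suc j) * M $$ (j, m) * g (Suc m)"
proof -
  have "mat_diag n (\<lambda>k. f (Suc k)) * M \<in> carrier_mat n n"
    using assms(1) by (intro mult_carrier_mat[of _ n n]) auto
  then show ?thesis
    unfolding diag_of_edge_vec
    by (subst mat_diag_mult_right, assumption) (use assms in \<open>auto simp: mat_diag_mult_left[OF assms(1)]\<close>)
qed

lemma W_entry:
  assumes "k < n" "m < n"
  shows "W_mat $$ (k, m) = (if k = m then (r (Suc m))\<^sup>2 + (x (Suc m))\<^sup>2 else 0)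
    - 2 * (r (Suc k) * path_mat n E $$ (k, m) * r (Suc m))
    - 2 * (x (Suc k) * path_mat n E $$ (k, m) * x (Suc m))"
proof -
  have sq: "(diag_of_vec (edge_vec n f) * diag_of_vec (edge_vec n f)) $$ (k, m)
      = (if k = m then (f (Suc m))\<^sup>2 else 0)" for f
    using assms by (simp add: diag_of_edge_vec) (simp add: mat_diag_def power2_eq_square)
  note neg = uminus_path_mat_carrier
  show ?thesis
    using assms R_carrier X_carrier neg sq[of r] sq[of x]
      diag_mult_entry[OF neg assms, of r r] diag_mult_entry[OF neg assms, of x x]
      path_mat_carrier[of n E]
    unfolding W_mat_def R_mat_def X_mat_def
    by (simp add: edge_diag_carrier[THEN carrier_matD(1)] edge_diag_carrier[THEN carrier_matD(2)]
      del: index_mult_mat(1))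
qed

text \<open>On the diagonal \<open>T\<close> is 1, so the squares are outweighed by twice
  themselves; off the diagonal only the negative terms remain.\<close>

lemma W_nonpos:
  assumes "k < n" "m < n"
  shows "W_mat $$ (k, m) \<le> 0"
proof -
  have nonneg: "r (Suc k) \<ge> 0" "r (Suc m) \<ge> 0" "x (Suc k) \<ge> 0" "x (Suc m) \<ge> 0"
    using assms impedance_nonneg by auto
  have T: "path_mat n E $$ (k, m) \<ge> 0" "k = m \<Longrightarrow> path_mat n E $$ (k, m) = 1"
    using assms by (auto simp: path_mat_def)
  have "0 \<le> r (Suc k) * path_mat n E $$ (k, m) * r (Suc m)"
    "0 \<le> x (Suc k) * path_mat n E $$ (k, m) * x (Suc m)"
    using nonneg T(1) by simp_all
  then show ?thesis
  proof (cases "k = m")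
    case True
    then show ?thesis
      using T(2) unfolding W_entry[OF assms] by (simp add: power2_eq_square)
  next
    case False
    then have "W_mat $$ (k, m) = - 2 * (r (Suc k) * path_mat n E $$ (k, m) * r (Suc m))
        - 2 * (x (Suc k) * path_mat n E $$ (k, m) * x (Suc m))"
      unfolding W_entry[OF assms] by simp
    then show ?thesis
      using \<open>0 \<le> r (Suc k) * path_mat n E $$ (k, m) * r (Suc m)\<close>
        \<open>0 \<le> x (Suc k) * path_mat n E $$ (k, m) * x (Suc m)\<close> by linarith
  qed
qed

lemma K_carrier: "K_mat \<in> carrier_mat n n"
  unfolding K_mat_def
  by (rule mult_carrier_mat[OF _ W_carrier]) (simp add: path_mat_carrier minus_carrier_mat)

text \<open>Both factors are nonpositive, since the diagonal of \<open>T\<close> is 1 and its other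
  entries are 0 or 1.\<close>

lemma K_nonneg:
  assumes "j < n" "m < n"
  shows "K_mat $$ (j, m) \<ge> 0"
proof -
  have "K_mat $$ (j, m) = (\<Sum>k<n. (1\<^sub>m n - path_mat n E) $$ (k, j) * W_mat $$ (k, m))"
    using assms path_mat_carrier[of n E] W_carrier
    by (auto simp: K_mat_def scalar_prod_def atLeast0LessThan)
  also have "\<dots> \<ge> 0"
    using assms W_nonpos by (intro sum_nonneg mult_nonpos_nonpos) (auto simp: path_mat_def)
  finally show ?thesis .
qed

lemma reduced_jacobian_eq:
  "reduced_jacobian n E r x (P, Q, L, v, p, q) =
    diag_of_vec ((Delta_mat n E)\<^sup>T *\<^sub>v node_vec n v)
    + 2 \<cdot>\<^sub>m (diag_of_vec (edge_vec n P) * - path_mat n E * R_mat)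
    + 2 \<cdot>\<^sub>m (diag_of_vec (edge_vec n Q) * - path_mat n E * X_mat)
    - diag_of_vec (edge_vec n L) * (Delta2_mat n E)\<^sup>T * (- path_mat n E)\<^sup>T * W_mat"
  unfolding reduced_jacobian_def Let_def mat_inv_A2 mat_inv_A2_transpose W_mat_def R_mat_def X_mat_def
    prod.case
  by (rule refl)

lemma diag_V_carrier: "diag_of_vec ((Delta_mat n E)\<^sup>T *\<^sub>v w) \<in> carrier_mat n n"
  using Delta_carrier[of n E] by (simp add: diag_of_vec_def)

lemma reduced_jacobian_carrier: "reduced_jacobian n E r x z \<in> carrier_mat n n"
proof (cases z)
  case (fields P Q L v p q)
  have "diag_of_vec (edge_vec n L) * (Delta2_mat n E)\<^sup>T * (- path_mat n E)\<^sup>T * W_mat \<in> carrier_mat n n"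
    by (intro mult_carrier_mat[where n = n] W_carrier edge_diag_carrier)
      (simp_all only: transpose_carrier_mat Delta2_carrier uminus_path_mat_carrier)
  then show ?thesis unfolding fields reduced_jacobian_eq by (rule minus_carrier_mat)
qed

text \<open>The sum selects the voltage at the parent. Each entry is thus visibly linear in the
  point, from which both signs and continuity are read off.\<close>

lemma reduced_jacobian_entry:
  assumes jm: "j < n" "m < n"
  shows "reduced_jacobian n E r x (P, Q, L, v, p, q) $$ (j, m) =
    (if j = m then \<Sum>i\<le>n. if (i, Suc j) \<in> E then v i else 0 else 0)
    - 2 * (P (Suc j) * path_mat n E $$ (j, m) * r (Suc m))
    - 2 * (Q (Suc j) * path_mat n E $$ (j, m) * x (Suc m))
    - L (Suc j) * K_mat $$ (j, m)"
proof -
  note T = path_mat_carrier[of n E] and D2 = Delta2_carrier[of n E]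
  note neg = uminus_path_mat_carrier
  have dV: "diag_of_vec ((Delta_mat n E)\<^sup>T *\<^sub>v node_vec n v) $$ (j, m)
      = (if j = m then \<Sum>i\<le>n. if (i, Suc j) \<in> E then v i else 0 else 0)"
  proof -
    have "((Delta_mat n E)\<^sup>T *\<^sub>v node_vec n v) $ j = (\<Sum>i<Suc n. (Delta_mat n E)\<^sup>T $$ (j, i) * node_vec n v $ i)"
      using jm by (intro mult_mat_vec_entry[of _ n]) (auto simp: Delta_carrier node_vec_def)
    also have "\<dots> = (\<Sum>i\<le>n. if (i, Suc j) \<in> E then v i else 0)"
      unfolding lessThan_Suc_atMost using jm
      by (intro sum.cong) (auto simp: Delta_mat_def node_vec_def)
    finally show ?thesis
      using jm Delta_carrier[of n E] by (auto simp: diag_of_vec_def mat_diag_def simp del: index_mult_mat_vec)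
  qed
  have "(Delta2_mat n E)\<^sup>T * (- path_mat n E)\<^sup>T = (1\<^sub>m n - path_mat n E)\<^sup>T"
  proof -
    have "(Delta2_mat n E)\<^sup>T * (- path_mat n E)\<^sup>T = (- path_mat n E * Delta2_mat n E)\<^sup>T"
      using transpose_mult[OF neg D2] by simp
    also have "- path_mat n E * Delta2_mat n E = 1\<^sub>m n - path_mat n E"
      using T D2 by (subst uminus_mult_left_mat) (auto simp: path_mat_Delta2 intro!: eq_matI)
    finally show ?thesis .
  qed
  moreover have "diag_of_vec (edge_vec n L) * (Delta2_mat n E)\<^sup>T * (- path_mat n E)\<^sup>T * W_mat
      = diag_of_vec (edge_vec n L) * ((Delta2_mat n E)\<^sup>T * (- path_mat n E)\<^sup>T * W_mat)"
    using T D2 W_carrier edge_diag_carrier[of n L]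
    by (simp add: assoc_mult_mat[of _ n n _ n _ n])
  ultimately have dL: "diag_of_vec (edge_vec n L) * (Delta2_mat n E)\<^sup>T * (- path_mat n E)\<^sup>T * W_mat
      = mat n n (\<lambda>(j, m). L (Suc j) * K_mat $$ (j, m))"
    unfolding diag_of_edge_vec K_mat_def[symmetric]
    by (simp add: K_mat_def[symmetric] mat_diag_mult_left[OF K_carrier])
  show ?thesis
    unfolding reduced_jacobian_eq dL using jm dV T diag_V_carrier[of "node_vec n v"]
      diag_mult_entry[OF neg jm, of P r] diag_mult_entry[OF neg jm, of Q x]
    unfolding R_mat_def X_mat_def
    by (simp add: edge_diag_carrier[THEN carrier_matD(1)] edge_diag_carrier[THEN carrier_matD(2)]
      del: index_mult_mat(1))
qed

text \<open>Here the nonnegative flows enter: an off-diagonal entry has no voltage term and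
  subtracts only products of nonnegative numbers.\<close>

lemma Z_matrix_reduced_jacobian:
  assumes "z \<in> operating_points n E r x"
  shows "Z_matrix n (reduced_jacobian n E r x z)"
proof (cases z)
  case (fields P Q L v p q)
  have flows: "P j \<ge> 0" "Q j \<ge> 0" "L j \<ge> 0" if "j \<in> {1..n}" for j
    using assms that unfolding fields operating_points_def power_flow_solutions_def by auto
  have "reduced_jacobian n E r x z $$ (i, j) \<le> 0" if "i < n" "j < n" "i \<noteq> j" for i j
  proof -
    have "P (Suc i) * path_mat n E $$ (i, j) * r (Suc j) \<ge> 0"
      "Q (Suc i) * path_mat n E $$ (i, j) * x (Suc j) \<ge> 0"
      "L (Suc i) * K_mat $$ (i, j) \<ge> 0"
      using flows[of "Suc i"] impedance_nonneg[of "Suc j"] K_nonneg that by (auto simp: path_mat_def)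
    then show ?thesis unfolding fields using that by (simp add: reduced_jacobian_entry)
  qed
  then show ?thesis by (simp add: Z_matrix_def reduced_jacobian_carrier)
qed

text \<open>A kernel vector \<open>y\<close> of the reduced Jacobian extends to one of the full Jacobian whose
  component along the squared currents is \<open>- y\<close>.\<close>

lemma det_jacobian_eq_zero:
  assumes "det (reduced_jacobian n E r x z) = 0"
  shows "det (jacobian n E r x z) = 0"
proof (cases z)
  case (fields P Q L v p q)
  let ?J = "reduced_jacobian n E r x z"
  obtain y where y: "y \<in> carrier_vec n" "y \<noteq> 0\<^sub>v n" "?J *\<^sub>v y = 0\<^sub>v n"
    using assms det_0_iff_vec_prod_zero[OF reduced_jacobian_carrier] by blast
  define U where "U = - path_mat n E"
  define dP where "dP = diag_of_vec (edge_vec n P)"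
  define dQ where "dQ = diag_of_vec (edge_vec n Q)"
  define dL where "dL = diag_of_vec (edge_vec n L)"
  define dV where "dV = diag_of_vec ((Delta_mat n E)\<^sup>T *\<^sub>v node_vec n v)"
  \<comment> \<open>The remaining blocks come from eliminating the first three block rows:
    \<open>d\<close> and \<open>e\<close> are the active and reactive flow changes, \<open>h\<close>
    is the voltage change, and \<open>a\<close>, \<open>b\<close> adjust the slack
    injections.\<close>
  define d where "d = U *\<^sub>v (R_mat *\<^sub>v y)"
  define e where "e = U *\<^sub>v (X_mat *\<^sub>v y)"
  define h where "h = U\<^sup>T *\<^sub>v (W_mat *\<^sub>v y)"
  define a where "a = vec 1 (\<lambda>_. - (A_mat n E *\<^sub>v d) $ 0)"
  define b where "b = vec 1 (\<lambda>_. - (A_mat n E *\<^sub>v e) $ 0)"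
  have U: "U \<in> carrier_mat n n" "A2_mat n E * U = 1\<^sub>m n"
    using path_mat_carrier path_mat_inverse by (auto simp: U_def)
  have dPQ: "dP \<in> carrier_mat n n" "dQ \<in> carrier_mat n n" "dL \<in> carrier_mat n n" "dV \<in> carrier_mat n n"
    by (auto simp: dP_def dQ_def dL_def dV_def edge_diag_carrier diag_V_carrier)
  note RX = R_carrier X_carrier W_carrier
  note A = A_carrier[of n E] A2_carrier[of n E] Delta2_carrier[of n E]
  have P: "Pi_mat n \<in> carrier_mat (Suc n) n" by (simp add: Pi_mat_def)
  have de: "d \<in> carrier_vec n" "e \<in> carrier_vec n" "h \<in> carrier_vec n" "- y \<in> carrier_vec n"
    unfolding d_def e_def h_def using U RX y(1) by auto
  have ab: "a \<in> carrier_vec 1" "b \<in> carrier_vec 1" by (auto simp: a_def b_def)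
  define e1 :: "real mat" where "e1 = mat_of_cols (Suc n) [unit_vec (Suc n) 0]"
  have e1: "e1 \<in> carrier_mat (Suc n) 1" by (auto simp: e1_def)
  have rowP: "(- A_mat n E) *\<^sub>v d + ((- (Pi_mat n * R_mat)) *\<^sub>v (- y) + (- e1) *\<^sub>v a) = 0\<^sub>v (Suc n)"
    unfolding d_def a_def e1_def by (rule power_balance_kernel[OF U R_carrier y(1)])
  have rowQ: "(- A_mat n E) *\<^sub>v e + ((- (Pi_mat n * X_mat)) *\<^sub>v (- y) + (- e1) *\<^sub>v b) = 0\<^sub>v (Suc n)"
    unfolding e_def b_def e1_def by (rule power_balance_kernel[OF U X_carrier y(1)])
  have Rd: "(R_mat * U * R_mat) *\<^sub>v y = R_mat *\<^sub>v d" "(X_mat * U * X_mat) *\<^sub>v y = X_mat *\<^sub>v e"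
    "(dP * U * R_mat) *\<^sub>v y = dP *\<^sub>v d" "(dQ * U * X_mat) *\<^sub>v y = dQ *\<^sub>v e"
    unfolding d_def e_def using RX U y(1) dPQ
    by (simp_all add: assoc_mult_mat_vec[of _ n n _ n])
  have A2h: "(A2_mat n E)\<^sup>T *\<^sub>v h = W_mat *\<^sub>v y"
  proof -
    have "(A2_mat n E)\<^sup>T *\<^sub>v h = ((A2_mat n E)\<^sup>T * U\<^sup>T) *\<^sub>v (W_mat *\<^sub>v y)"
      unfolding h_def using A U RX y(1) by (intro assoc_mult_mat_vec[symmetric]) auto
    then show ?thesis
      using A2_transpose_inverse RX y(1) unfolding U_def[symmetric] by auto
  qed
  have Wy: "W_mat *\<^sub>v y = (R_mat * R_mat) *\<^sub>v y + 2 \<cdot>\<^sub>v (R_mat *\<^sub>v d) + (X_mat * X_mat) *\<^sub>v y + 2 \<cdot>\<^sub>v (X_mat *\<^sub>v e)"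
    unfolding W_mat_def U_def[symmetric] Rd[symmetric] using RX U y(1)
    by (simp add: add_mult_distrib_mat_vec[of _ n n] smult_mat_mult_vec[of _ n n])
  \<comment> \<open>The impedance terms add up to \<open>- W_mat\<close> applied to
    \<open>y\<close>, which the voltage term \<open>A2h\<close> cancels.\<close>
  have row3: "((- 2) \<cdot>\<^sub>m R_mat) *\<^sub>v d + (((- 2) \<cdot>\<^sub>m X_mat) *\<^sub>v e
      + ((R_mat * R_mat + X_mat * X_mat) *\<^sub>v (- y) + (A2_mat n E)\<^sup>T *\<^sub>v h)) = 0\<^sub>v n"
    unfolding A2h Wy using RX y(1) de
    by (intro eq_vecI) (auto simp: mult_mat_vec_uminus[of _ n n] add_mult_distrib_mat_vec[of _ n n] smult_mat_mult_vec[of _ n n] simp del: index_mult_mat_vec)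
  have Jy: "?J *\<^sub>v y = dV *\<^sub>v y + 2 \<cdot>\<^sub>v (dP *\<^sub>v d) + 2 \<cdot>\<^sub>v (dQ *\<^sub>v e) - (dL * (Delta2_mat n E)\<^sup>T) *\<^sub>v h"
  proof -
    have h: "(dL * (Delta2_mat n E)\<^sup>T * U\<^sup>T * W_mat) *\<^sub>v y = (dL * (Delta2_mat n E)\<^sup>T) *\<^sub>v h"
      unfolding h_def using dPQ A U RX y(1) by (simp add: assoc_mult_mat_vec[of _ n n _ n])
    show ?thesis
      unfolding fields reduced_jacobian_eq U_def[symmetric] dP_def[symmetric] dQ_def[symmetric]
        dL_def[symmetric] dV_def[symmetric] Rd[symmetric] h[symmetric]
      using dPQ A U RX y(1)
      by (intro linear_combination_mult_vec[where n = n] mult_carrier_mat[where n = n]) auto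
  qed
  \<comment> \<open>After this elimination the last block row is the reduced Jacobian applied to
    \<open>y\<close>.\<close>
  have row4: "(2 \<cdot>\<^sub>m dP) *\<^sub>v d + ((2 \<cdot>\<^sub>m dQ) *\<^sub>v e
      + ((- dV) *\<^sub>v (- y) + (- (dL * (Delta2_mat n E)\<^sup>T)) *\<^sub>v h)) = 0\<^sub>v n"
  proof -
    have "(2 \<cdot>\<^sub>m dP) *\<^sub>v d + ((2 \<cdot>\<^sub>m dQ) *\<^sub>v e
      + ((- dV) *\<^sub>v (- y) + (- (dL * (Delta2_mat n E)\<^sup>T)) *\<^sub>v h)) = ?J *\<^sub>v y"
      unfolding Jy using dPQ A de y(1)
      by (intro eq_vecI) (auto simp: mult_mat_vec_uminus[of _ n n] smult_mat_mult_vec[of _ n n] simp del: index_mult_mat_vec)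
    then show ?thesis using y(3) by simp
  qed
  define u where "u = d @\<^sub>v e @\<^sub>v (- y) @\<^sub>v h @\<^sub>v a @\<^sub>v b"
  have u: "u \<in> carrier_vec (4 * n + 2)"
  proof -
    have "u \<in> carrier_vec (n + (n + (n + (n + (1 + 1)))))"
      unfolding u_def using de ab by (intro append_carrier_vec)
    then show ?thesis by (simp add: numeral_eq_Suc)
  qed
  have "u \<noteq> 0\<^sub>v (4 * n + 2)"
  proof
    assume u0: "u = 0\<^sub>v (4 * n + 2)"
    have "y $ i = 0" if "i < n" for i
    proof -
      \<comment> \<open>The block \<open>- y\<close> starts after the two flow blocks, at offset
        \<open>2 n\<close>.\<close>
      have "u $ (n + (n + i)) = - y $ i"
        unfolding u_def using de ab y(1) that by (auto simp: a_def b_def)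
      then show ?thesis unfolding u0 using that by simp
    qed
    then have "y = 0\<^sub>v n" using y(1) by (intro eq_vecI) auto
    with y(2) show False by simp
  qed
  let ?Z = "0\<^sub>m (Suc n) n :: real mat" and ?z1 = "0\<^sub>m (Suc n) 1 :: real mat" and ?z2 = "0\<^sub>m n 1 :: real mat"
  let ?c = "n + (n + (n + (n + (1 + 1))))"
  let ?r1 = "- A_mat n E @\<^sub>c ?Z @\<^sub>c - (Pi_mat n * R_mat) @\<^sub>c ?Z @\<^sub>c - e1 @\<^sub>c ?z1"
  let ?r2 = "?Z @\<^sub>c - A_mat n E @\<^sub>c - (Pi_mat n * X_mat) @\<^sub>c ?Z @\<^sub>c ?z1 @\<^sub>c - e1"
  let ?r3 = "(- 2) \<cdot>\<^sub>m R_mat @\<^sub>c (- 2) \<cdot>\<^sub>m X_mat @\<^sub>c (R_mat * R_mat + X_mat * X_mat)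
    @\<^sub>c (A2_mat n E)\<^sup>T @\<^sub>c ?z2 @\<^sub>c ?z2"
  let ?r4 = "2 \<cdot>\<^sub>m dP @\<^sub>c 2 \<cdot>\<^sub>m dQ @\<^sub>c - dV @\<^sub>c - (dL * (Delta2_mat n E)\<^sup>T) @\<^sub>c ?z2 @\<^sub>c ?z2"
  have jac: "jacobian n E r x z = ?r1 @\<^sub>r ?r2 @\<^sub>r ?r3 @\<^sub>r ?r4"
    unfolding fields jacobian_def Let_def R_mat_def X_mat_def dP_def dQ_def dL_def dV_def e1_def prod.case by (rule refl)
  have Zc: "?Z \<in> carrier_mat (Suc n) n" "?z1 \<in> carrier_mat (Suc n) 1" "?z2 \<in> carrier_mat n 1" by auto
  have c1: "- A_mat n E \<in> carrier_mat (Suc n) n" "- (Pi_mat n * R_mat) \<in> carrier_mat (Suc n) n"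
    "- (Pi_mat n * X_mat) \<in> carrier_mat (Suc n) n" "- e1 \<in> carrier_mat (Suc n) 1"
    using A P RX e1 by auto
  have c3: "(- 2) \<cdot>\<^sub>m R_mat \<in> carrier_mat n n" "(- 2) \<cdot>\<^sub>m X_mat \<in> carrier_mat n n"
    "R_mat * R_mat + X_mat * X_mat \<in> carrier_mat n n" "(A2_mat n E)\<^sup>T \<in> carrier_mat n n"
    using A RX by auto
  have c4: "2 \<cdot>\<^sub>m dP \<in> carrier_mat n n" "2 \<cdot>\<^sub>m dQ \<in> carrier_mat n n"
    "- dV \<in> carrier_mat n n" "- (dL * (Delta2_mat n E)\<^sup>T) \<in> carrier_mat n n"
    using A dPQ by auto
  note b1 = append_cols6_mult_vec[OF c1(1) Zc(1) c1(2) Zc(1) c1(4) Zc(2) de(1,2,4,3) ab, folded u_def]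
  note b2 = append_cols6_mult_vec[OF Zc(1) c1(1,3) Zc(1,2) c1(4) de(1,2,4,3) ab, folded u_def]
  note b3 = append_cols6_mult_vec[OF c3 Zc(3,3) de(1,2,4,3) ab, folded u_def]
  note b4 = append_cols6_mult_vec[OF c4 Zc(3,3) de(1,2,4,3) ab, folded u_def]
  have zeros: "?Z *\<^sub>v d = 0\<^sub>v (Suc n)" "?Z *\<^sub>v e = 0\<^sub>v (Suc n)" "?Z *\<^sub>v h = 0\<^sub>v (Suc n)"
    "?z1 *\<^sub>v a = 0\<^sub>v (Suc n)" "?z1 *\<^sub>v b = 0\<^sub>v (Suc n)" "?z2 *\<^sub>v a = 0\<^sub>v n" "?z2 *\<^sub>v b = 0\<^sub>v n"
    using de ab by (auto intro!: eq_vecI)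
  have u': "u \<in> carrier_vec ?c" using u by (simp add: numeral_eq_Suc)
  have "?r1 *\<^sub>v u = 0\<^sub>v (Suc n)"
    unfolding b1(2) zeros using rowP de ab c1 y(1)
    by (simp del: index_mult_mat_vec uminus_mult_mat_vec add: mult_mat_vec_carrier[of _ _ n] mult_mat_vec_carrier[of _ _ 1, simplified])
  moreover have "?r2 *\<^sub>v u = 0\<^sub>v (Suc n)"
    unfolding b2(2) zeros using rowQ de ab c1 y(1)
    by (simp del: index_mult_mat_vec uminus_mult_mat_vec add: mult_mat_vec_carrier[of _ _ n] mult_mat_vec_carrier[of _ _ 1, simplified])
  moreover have "?r3 *\<^sub>v u = 0\<^sub>v n"
    unfolding b3(2) zeros using row3 de ab c3 y(1)
    by (simp del: index_mult_mat_vec uminus_mult_mat_vec add: mult_mat_vec_carrier[of _ _ n] mult_mat_vec_carrier[of _ _ 1, simplified])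
  moreover have "?r4 *\<^sub>v u = 0\<^sub>v n"
    unfolding b4(2) zeros using row4 de ab c4 y(1)
    by (simp del: index_mult_mat_vec uminus_mult_mat_vec add: mult_mat_vec_carrier[of _ _ n] mult_mat_vec_carrier[of _ _ 1, simplified])
  moreover note r34 = carrier_append_rows[OF b3(1) b4(1)]
  moreover note r234 = carrier_append_rows[OF b2(1) r34]
  ultimately have "jacobian n E r x z *\<^sub>v u = 0\<^sub>v (Suc n) @\<^sub>v 0\<^sub>v (Suc n) @\<^sub>v 0\<^sub>v n @\<^sub>v 0\<^sub>v n"
    unfolding jac
    by (simp only: mat_mult_append[OF b1(1) r234 u'] mat_mult_append[OF b2(1) r34 u']
      mat_mult_append[OF b3(1) b4(1) u'])
  also have "\<dots> = 0\<^sub>v (4 * n + 2)" by (intro eq_vecI) auto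
  finally have "jacobian n E r x z *\<^sub>v u = 0\<^sub>v (4 * n + 2)" .
  moreover have "jacobian n E r x z \<in> carrier_mat (4 * n + 2) (4 * n + 2)"
    using carrier_append_rows[OF b1(1) carrier_append_rows[OF b2(1) carrier_append_rows[OF b3(1) b4(1)]]]
    unfolding jac by (simp add: numeral_eq_Suc)
  ultimately show ?thesis
    using det_0_iff_vec_prod_zero u \<open>u \<noteq> 0\<^sub>v (4 * n + 2)\<close> by blast
qed

text \<open>Without flows and currents only the parent voltages survive, and they are all 1.\<close>

lemma reduced_jacobian_flat: "reduced_jacobian n E r x (flat_voltage_solution n) = 1\<^sub>m n"
proof (rule eq_matI)
  fix j m assume "j < dim_row (1\<^sub>m n :: real mat)" "m < dim_col (1\<^sub>m n :: real mat)"
  then have jm: "j < n" "m < n" by auto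
  obtain p where p: "(p, Suc j) \<in> E" using parent_exists[OF jm(1)] by blast
  have "(\<Sum>i\<le>n. if (i, Suc j) \<in> E then (if i \<le> n then 1 else 0) else 0) = (\<Sum>i\<le>n. if i = p then 1 else (0 :: real))"
    by (intro sum.cong) (auto simp: parent_iff[OF p])
  also have "\<dots> = 1" using edge_range[OF p] by simp
  finally show "reduced_jacobian n E r x (flat_voltage_solution n) $$ (j, m) = 1\<^sub>m n $$ (j, m)"
    unfolding flat_voltage_solution_def using jm
    by (cases "j = m") (simp_all add: reduced_jacobian_entry)
qed (use reduced_jacobian_carrier[of "flat_voltage_solution n"] in auto)

end

section \<open>Connectedness of the stability region\<close>

text \<open>The Leibniz formula is a polynomial in the entries.\<close>

lemma continuous_on_det:
  fixes M :: "'b :: topological_space \<Rightarrow> real mat"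
  assumes carr: "\<And>z. M z \<in> carrier_mat n n"
    and cont: "\<And>i j. i < n \<Longrightarrow> j < n \<Longrightarrow> continuous_on S (\<lambda>z. M z $$ (i, j))"
  shows "continuous_on S (\<lambda>z. det (M z))"
proof -
  have "continuous_on S (\<lambda>z. \<Prod>i = 0..<n. M z $$ (i, p i))" if "p permutes {0..<n}" for p
    using permutes_in_image[OF that] by (intro continuous_on_prod cont) auto
  then show ?thesis
    unfolding det_def'[OF carr] by (intro continuous_on_sum continuous_on_mult continuous_on_const) auto
qed

context radial_network
begin

lemma continuous_on_reduced_jacobian:
  assumes "j < n" "m < n"
  shows "continuous_on S (\<lambda>z. reduced_jacobian n E r x z $$ (j, m))"
proof -
  have *: "reduced_jacobian n E r x z $$ (j, m) =
    (if j = m then \<Sum>i\<le>n. if (i, Suc j) \<in> E then (fst (snd (snd (snd z)))) i else 0 else 0)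
    - 2 * (fst z (Suc j) * path_mat n E $$ (j, m) * r (Suc m))
    - 2 * (fst (snd z) (Suc j) * path_mat n E $$ (j, m) * x (Suc m))
    - fst (snd (snd z)) (Suc j) * K_mat $$ (j, m)" for z
    by (cases z) (simp only: reduced_jacobian_entry[OF assms] fst_conv snd_conv)
  have edge: "continuous_on S (\<lambda>z. if b then f z else (0 :: real))"
    if "continuous_on S f" for b and f :: "point \<Rightarrow> real"
    using that by (cases b) auto
  show ?thesis
    unfolding * by (intro edge continuous_intros continuous_on_product_then_coordinatewise)
qed

text \<open>On the region semipositivity is the open condition \<open>Pos\<close> and its failure
  the open condition \<open>Neg\<close>; a connected set that meets \<open>Pos\<close> and is split
  by the two cannot meet \<open>Neg\<close>.\<close>

lemma semipositive_reduced_jacobian: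
  assumes z: "z \<in> voltage_stability_region n E r x"
  shows "semipositive n (reduced_jacobian n E r x z)"
    and "Z_matrix n (reduced_jacobian n E r x z)"
proof -
  let ?J = "reduced_jacobian n E r x"
  let ?X = "{z \<in> operating_points n E r x. det (jacobian n E r x z) \<noteq> 0}"
  let ?C = "voltage_stability_region n E r x" and ?flat = "flat_voltage_solution n"
  define c where "c k z = det (replace_col (?J z) (vec n (\<lambda>_. 1)) k) * det (?J z)" for k z
  define Pos where "Pos = (\<Union>w\<in>{w. \<forall>i<n. w i > 0}. \<Inter>i\<in>{..<n}. {z. 0 < (\<Sum>j<n. ?J z $$ (i, j) * w j)})"
  define Neg where "Neg = (\<Union>k\<in>{..<n}. {z. c k z < 0})"
  have Pos: "z \<in> Pos \<longleftrightarrow> semipositive n (?J z)" for z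
    unfolding Pos_def semipositive_def by auto
  have sub: "?C \<subseteq> ?X"
    unfolding voltage_stability_region_def by (rule connected_component_subset)
  \<comment> \<open>A nonsingular full Jacobian forces a nonsingular reduced one, as the Cramer
    criterion requires.\<close>
  have Zm: "Z_matrix n (?J z)" "det (?J z) \<noteq> 0" if "z \<in> ?C" for z
    using that sub Z_matrix_reduced_jacobian det_jacobian_eq_zero by blast+
  have split: "z \<in> Pos \<longleftrightarrow> z \<notin> Neg" if "z \<in> ?C" for z
    using semipositive_iff_cramer[OF Zm[OF that]] by (auto simp: Pos Neg_def c_def not_less)
  \<comment> \<open>The component contains \<open>z\<close>, so it is nonempty and its base point
    lies in the underlying set.\<close>
  have "?flat \<in> ?C"
    using z connected_component_in[of ?X ?flat z] connected_component_refl[of ?flat ?X]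
    unfolding voltage_stability_region_def by auto
  moreover have "?flat \<in> Pos"
  proof -
    have "(\<Sum>j<n. 1\<^sub>m n $$ (i, j) * 1) = (1 :: real)" if "i < n" for i
      using that by (simp add: one_mat_def)
    then show ?thesis
      unfolding Pos reduced_jacobian_flat semipositive_def by (intro exI[of _ "\<lambda>_. 1"]) simp
  qed
  moreover have "connected ?C"
    unfolding voltage_stability_region_def by (rule connected_connected_component)
  \<comment> \<open>Each \<open>w\<close> contributes finitely many strict inequalities between
    continuous functions, and unions of open sets are open.\<close>
  moreover have "open Pos"
    unfolding Pos_def
    by (intro open_UN ballI open_INT finite_lessThan open_Collect_less continuous_intros
        continuous_on_reduced_jacobian) auto
  moreover have "open Neg"
    unfolding Neg_def
  proof (intro open_UN ballI open_Collect_less continuous_on_const)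
    fix k
    have "continuous_on UNIV (\<lambda>z. det (?J z))"
      by (intro continuous_on_det[of _ n] reduced_jacobian_carrier continuous_on_reduced_jacobian)
    moreover have "continuous_on UNIV (\<lambda>z. det (replace_col (?J z) (vec n (\<lambda>_. 1)) k))"
    proof (rule continuous_on_det[of _ n])
      show "replace_col (?J z) (vec n (\<lambda>_. 1)) k \<in> carrier_mat n n" for z
        using reduced_jacobian_carrier[of z] by (auto simp: replace_col_def)
      show "continuous_on UNIV (\<lambda>z. replace_col (?J z) (vec n (\<lambda>_. 1)) k $$ (i, j))"
        if "i < n" "j < n" for i j
        using that continuous_on_reduced_jacobian[OF that]
          carrier_matD[OF reduced_jacobian_carrier]
        by (cases "j = k") (simp_all add: replace_col_def)
    qed
    ultimately show "continuous_on UNIV (c k)"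
      unfolding c_def[abs_def] by (intro continuous_on_mult)
  qed
  ultimately have "Neg \<inter> ?C = {}"
    using split connectedD[of ?C Pos Neg] by blast
  then show "semipositive n (?J z)" using split[OF z] z Pos by blast
  show "Z_matrix n (?J z)" by (rule Zm[OF z])
qed

end

theorem theorem2:
  fixes n :: nat and E :: "(nat \<times> nat) set" and r x :: "nat \<Rightarrow> real"
    and z :: point and J :: "real mat"
  assumes "n \<ge> 1"
    and "rooted_tree n E"
    and "\<forall>j\<in>{1..n}. r j \<ge> 0 \<and> x j \<ge> 0"
    and "z \<in> voltage_stability_region n E r x"
    and "J = reduced_jacobian n E r x z"
  shows "invertible_mat (A2_mat n E) \<and>
    det J > 0 \<and> (\<forall>j<n. J $$ (j, j) > 0) \<and> rho J < 1 \<and>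
    VSI J \<le> AVSI J \<and> AVSI J \<le> VSI J - rho J * ln (1 - rho J)"
proof -
  interpret radial_network n E r x
    using assms(2,3) by unfold_locales auto
  note J = semipositive_reduced_jacobian(2,1)[OF assms(4), folded assms(5)]
  note bounds = VSI_AVSI_bounds[OF J]
  show ?thesis
    using invertible_A2 bounds assms(1) by auto
qed

end
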